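(* Let $F_1=\sigma_x\otimes(-i\sigma_x)$, $F_2=\sigma_x\otimes(-i\sigma_y)$, $F_3=\sigma_x\otimes(-i\sigma_z)$, $F_4=(i\sigma_z)\otimes I_2$, $F_5=J_4=\begin{pmatrix}0&I_2\\-I_2&0\end{pmatrix}$ in $M(4,\mathbb{C})$, and let $B=\{F_1,\dots,F_5\}$. Then $B$ is a basis for a space $V$ of $1$-vectors for $Cl(0,5)=M(4,\mathbb{C})$. With respect to $B$ the following hold, where $\widehat{J}_4=M_{1\otimes i}=J_2\oplus(-J_2)$ and $J_2=\begin{pmatrix}0&1\\-1&0\end{pmatrix}$: (i) Reversion on $Cl(0,5)$ is given by $\phi^{rev}(X)=\widehat{J}_4^{-1}X^T\widehat{J}_4$. (ii) Clifford conjugation is given by $\phi^{cc}(X)=X^*$. (iii) $Spin(5)=\widehat{Sp}(4):=\{X\in M(4,\mathbb{C}) : X^*X=I_4,\ X^T\widehat{J}_4X=\widehat{J}_4\}$. (iv) The standard covering map $\Phi_5:Spin(5)\to SO(5,\mathbb{R})$ sends $G\in\widehat{Sp}(4)$ to the matrix, with respect to the basis $B$, of the linear map $V\to V$, $Y\mapsto GYG^*$. (v) The Lie algebra isomorphism $\Psi_5:\widehat{sp}(4)\to\mathfrak{so}(5,\mathbb{R})$ obtained by linearizing $\Phi_5$, where $\widehat{sp}(4)=\{X\in M(4,\mathbb{C}): X^*=-X,\ X^T\widehat{J}_4=-\widehat{J}_4X\}$ is the Lie algebra of $\widehat{Sp}(4)$, sends $A\in\widehat{sp}(4)$ to the matrix,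 with respect to $B$, of the linear map $V\to V$, $Z\mapsto AZ-ZA$.
   Context: Pauli matrices: $\sigma_x=\begin{pmatrix}0&1\\1&0\end{pmatrix}$, $\sigma_y=\begin{pmatrix}0&-i\\i&0\end{pmatrix}$, $\sigma_z=\begin{pmatrix}1&0\\0&-1\end{pmatrix}$; $\otimes$ between matrices is the Kronecker product; $X^*$ is the conjugate transpose. $Cl(p,q)$ is the real Clifford algebra generated by $p+q$ pairwise anticommuting generators, $p$ of which square to $+1$ and $q$ to $-1$. To say that a set of matrices in a matrix algebra $\mathcal{A}$ (viewed as a real algebra) is a basis of $1$-vectors for $Cl(p,q)=\mathcal{A}$ means that they satisfy these relations and that $\mathcal{A}$ is thereby identified with $Cl(p,q)$; the space of $1$-vectors is their real span. Reversion $\phi^{rev}$ (resp. Clifford conjugation $\phi^{cc}$) is the unique real-linear anti-automorphism with $\phi(1)=1$ and $\phi^{rev}(v)=v$ (resp. $\phi^{cc}(v)=-v$) for all $1$-vectors $v$. The grade automorphism is $\phi^{gr}=\phi^{rev}\circ\phi^{cc}$. $Spin(n)$ is the set of $x\in Cl(0,n)$ with $\phi^{gr}(x)=x$, $x\phi^{cc}(x)=1$, and $xv\phi^{cc}(x)$ a $1$-vector for every $1$-vector $v$. The standard covering map sends $x\in Spin(n)$ to the matrix (in the given basis of $1$-vectors) of $v\mapsto xv\phi^{cc}(x)$. For quaternions $p,q$, $M_{p\otimes q}\in M(4,\mathbb{R})$ is the matrix of $x\mapsto px\bar q$ on $\mathbb{H}\cong\mathbb{R}^4$ with respect to the basis $1,i,j,k$.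 *)

theory Defs
  imports "HOL-Analysis.Analysis" "HOL-Library.Poly_Mapping"
begin

type_synonym 'm cmat = "complex^'m^'m"

definition cscale :: "complex \<Rightarrow> 'm::finite cmat \<Rightarrow> 'm cmat" where
  "cscale c X = map_matrix (\<lambda>z. c * z) X"

definition conj_transpose :: "'m::finite cmat \<Rightarrow> 'm cmat" where
  "conj_transpose X = (\<chi> i j. cnj (X $ j $ i))"

definition commutator :: "'a::ring_1^'m::finite^'m \<Rightarrow> 'a^'m^'m \<Rightarrow> 'a^'m^'m" where
  "commutator X Y = X ** Y - Y ** X"


section \<open>Clifford algebras by generators and relations\<close>

text \<open>
  The free monoid on \<open>'i\<close>, written additively so that \<open>'i fword \<Rightarrow>\<^sub>0 real\<close> with the
  convolution product of \<^theory>\<open>HOL-Library.Poly_Mapping\<close> is the free unital associative real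
  algebra on \<open>'i\<close>.
\<close>

datatype 'i fword = FWord (letters: "'i list")

instantiation fword :: (type) monoid_add
begin
definition zero_fword :: "'a fword" where "0 = FWord []"
definition plus_fword :: "'a fword \<Rightarrow> 'a fword \<Rightarrow> 'a fword" where
  "u + v = FWord (letters u @ letters v)"
instance by standard (auto simp: zero_fword_def plus_fword_def)
end

type_synonym 'i free_alg = "'i fword \<Rightarrow>\<^sub>0 real"

definition free_gen :: "'i \<Rightarrow> 'i free_alg" where
  "free_gen i = Poly_Mapping.single (FWord [i]) 1"

definition free_const :: "real \<Rightarrow> 'i free_alg" where
  "free_const c = Poly_Mapping.single 0 c"

inductive_set two_sided_ideal :: "'a::ring_1 set \<Rightarrow> 'a set" for R where
  zero: "0 \<in> two_sided_ideal R"
| base: "r \<in> R \<Longrightarrow> r \<in> two_sided_ideal R"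
| plus: "x \<in> two_sided_ideal R \<Longrightarrow> y \<in> two_sided_ideal R \<Longrightarrow> x + y \<in> two_sided_ideal R"
| left: "x \<in> two_sided_ideal R \<Longrightarrow> a * x \<in> two_sided_ideal R"
| right: "x \<in> two_sided_ideal R \<Longrightarrow> x * a \<in> two_sided_ideal R"

text \<open>\<open>\<eta> i\<close> is the square of the generator \<open>i\<close>.\<close>

definition clifford_relators :: "('i \<Rightarrow> real) \<Rightarrow> 'i free_alg set" where
  "clifford_relators \<eta> =
     {free_gen i * free_gen j + free_gen j * free_gen i | i j. i \<noteq> j} \<union>
     {free_gen i * free_gen i - free_const (\<eta> i) | i. True}"

definition fword_prod :: "('i \<Rightarrow> 'm::finite cmat) \<Rightarrow> 'i fword \<Rightarrow> 'm cmat" where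
  "fword_prod F w = foldr (\<lambda>i X. F i ** X) (letters w) (mat 1)"

definition free_eval :: "('i \<Rightarrow> 'm::finite cmat) \<Rightarrow> 'i free_alg \<Rightarrow> 'm cmat" where
  "free_eval F x = (\<Sum>w\<in>Poly_Mapping.keys x. Poly_Mapping.lookup x w *\<^sub>R fword_prod F w)"

text \<open>
  The family \<open>F\<close> is a basis of 1-vectors for \<open>Cl(p,q) = M(m,\<complex>)\<close>. It satisfies the Clifford
  relations, and the last two conditions say that the induced homomorphism from \<open>Cl(p,q)\<close>, the free
  algebra modulo the ideal of the Clifford relations, to the matrix algebra is bijective.
\<close>

definition one_vector_basis ::
    "nat \<Rightarrow> nat \<Rightarrow> ('i::finite \<Rightarrow> 'm::finite cmat) \<Rightarrow> bool" where
  "one_vector_basis p q F \<longleftrightarrow>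
     (\<exists>\<eta>. range \<eta> \<subseteq> {1, -1} \<and> card {i. \<eta> i = 1} = p \<and> card {i. \<eta> i = -1} = q \<and>
        (\<forall>i j. i \<noteq> j \<longrightarrow> F i ** F j = - (F j ** F i)) \<and>
        (\<forall>i. F i ** F i = \<eta> i *\<^sub>R mat 1) \<and>
        surj (free_eval F) \<and>
        {x. free_eval F x = 0} = two_sided_ideal (clifford_relators \<eta>))"


section \<open>Involutions, spin groups and covering maps\<close>

definition anti_automorphism :: "('m::finite cmat \<Rightarrow> 'm cmat) \<Rightarrow> bool" where
  "anti_automorphism \<phi> \<longleftrightarrow> linear \<phi> \<and> bij \<phi> \<and> (\<forall>X Y. \<phi> (X ** Y) = \<phi> Y ** \<phi> X)"

text \<open>In what follows \<open>V\<close> is the space of 1-vectors in the matrix algebra.\<close>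

definition is_reversion :: "'m::finite cmat set \<Rightarrow> ('m cmat \<Rightarrow> 'm cmat) \<Rightarrow> bool" where
  "is_reversion V \<phi> \<longleftrightarrow> anti_automorphism \<phi> \<and> \<phi> (mat 1) = mat 1 \<and> (\<forall>v\<in>V. \<phi> v = v)"

definition is_clifford_conj :: "'m::finite cmat set \<Rightarrow> ('m cmat \<Rightarrow> 'm cmat) \<Rightarrow> bool" where
  "is_clifford_conj V \<phi> \<longleftrightarrow> anti_automorphism \<phi> \<and> \<phi> (mat 1) = mat 1 \<and> (\<forall>v\<in>V. \<phi> v = - v)"

definition reversion :: "'m::finite cmat set \<Rightarrow> 'm cmat \<Rightarrow> 'm cmat" where
  "reversion V = (THE \<phi>. is_reversion V \<phi>)"

definition clifford_conj :: "'m::finite cmat set \<Rightarrow> 'm cmat \<Rightarrow> 'm cmat" where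
  "clifford_conj V = (THE \<phi>. is_clifford_conj V \<phi>)"

definition grade_aut :: "'m::finite cmat set \<Rightarrow> 'm cmat \<Rightarrow> 'm cmat" where
  "grade_aut V = reversion V \<circ> clifford_conj V"

definition Spin :: "'m::finite cmat set \<Rightarrow> 'm cmat set" where
  "Spin V = {x. grade_aut V x = x \<and> x ** clifford_conj V x = mat 1 \<and>
                (\<forall>v\<in>V. x ** v ** clifford_conj V x \<in> V)}"

text \<open>Column \<open>j\<close> holds the coordinates of \<open>T (F j)\<close>; \<open>F\<close> is meant to be an injective enumeration
  of a real-linearly independent set.\<close>

definition matrix_wrt ::
    "('n::finite \<Rightarrow> 'm::finite cmat) \<Rightarrow> ('m cmat \<Rightarrow> 'm cmat) \<Rightarrow> real^'n^'n" where
  "matrix_wrt F T = (\<chi> i j. representation (range F) (T (F j)) (F i))"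

definition spin_cover :: "('n::finite \<Rightarrow> 'm::finite cmat) \<Rightarrow> 'm cmat \<Rightarrow> real^'n^'n" where
  "spin_cover F x = matrix_wrt F (\<lambda>v. x ** v ** clifford_conj (span (range F)) x)"


section \<open>Lie algebras of matrix groups and linearization\<close>

definition curve_at_one :: "'m::finite cmat set \<Rightarrow> (real \<Rightarrow> 'm cmat) \<Rightarrow> 'm cmat \<Rightarrow> bool" where
  "curve_at_one G \<gamma> A \<longleftrightarrow>
     \<gamma> C1_differentiable_on UNIV \<and> range \<gamma> \<subseteq> G \<and> \<gamma> 0 = mat 1 \<and>
     (\<gamma> has_vector_derivative A) (at 0)"

definition lie_algebra_of :: "'m::finite cmat set \<Rightarrow> 'm cmat set" where
  "lie_algebra_of G = {A. \<exists>\<gamma>. curve_at_one G \<gamma> A}"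

text \<open>The differential at the identity of a map \<open>\<Phi>\<close> defined on \<open>G\<close>; it is meaningful on
  \<^term>\<open>lie_algebra_of G\<close> only.\<close>

definition linearization ::
    "'m::finite cmat set \<Rightarrow> ('m cmat \<Rightarrow> real^'n^'n) \<Rightarrow> 'm cmat \<Rightarrow> real^'n^'n" where
  "linearization G \<Phi> A =
     (THE D. \<forall>\<gamma>. curve_at_one G \<gamma> A \<longrightarrow> (\<Phi> \<circ> \<gamma> has_vector_derivative D) (at 0))"

definition lie_algebra_iso ::
    "'m::finite cmat set \<Rightarrow> (real^'n^'n) set \<Rightarrow> ('m cmat \<Rightarrow> real^'n::finite^'n) \<Rightarrow> bool" where
  "lie_algebra_iso \<gg> \<hh> \<psi> \<longleftrightarrow>
     bij_betw \<psi> \<gg> \<hh> \<and>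
     (\<forall>X\<in>\<gg>. \<forall>Y\<in>\<gg>. \<psi> (X + Y) = \<psi> X + \<psi> Y) \<and>
     (\<forall>c. \<forall>X\<in>\<gg>. \<psi> (c *\<^sub>R X) = c *\<^sub>R \<psi> X) \<and>
     (\<forall>X\<in>\<gg>. \<forall>Y\<in>\<gg>. \<psi> (commutator X Y) = commutator (\<psi> X) (\<psi> Y))"

definition SO :: "(real^'n::finite^'n) set" where
  "SO = {R. rotation_matrix R}"

definition so :: "(real^'n::finite^'n) set" where
  "so = {R. transpose R = - R}"


section \<open>The matrices in \<open>M(4,\<complex>)\<close>\<close>

text \<open>Position in \<open>1,\<dots>,4\<close> as block number and position inside the block, for 4x4 matrices made of
  2x2 blocks.\<close>

definition blk :: "4 \<Rightarrow> 2" where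
  "blk i = (if i = 1 \<or> i = 2 then 1 else 2)"

definition pos :: "4 \<Rightarrow> 2" where
  "pos i = (if i = 1 \<or> i = 3 then 1 else 2)"

definition kron :: "2 cmat \<Rightarrow> 2 cmat \<Rightarrow> 4 cmat" where
  "kron A B = (\<chi> i j. A $ blk i $ blk j * B $ pos i $ pos j)"

definition block4 :: "'a^2^2 \<Rightarrow> 'a^2^2 \<Rightarrow> 'a^2^2 \<Rightarrow> 'a^2^2 \<Rightarrow> 'a^4^4" where
  "block4 A B C D = (\<chi> i j.
     (if blk i = 1 then (if blk j = 1 then A else B) else (if blk j = 1 then C else D))
       $ pos i $ pos j)"

definition sigma_x :: "2 cmat" where
  "sigma_x = vector [vector [0, 1], vector [1, 0]]"

definition sigma_y :: "2 cmat" where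
  "sigma_y = vector [vector [0, - \<i>], vector [\<i>, 0]]"

definition sigma_z :: "2 cmat" where
  "sigma_z = vector [vector [1, 0], vector [0, -1]]"

definition J2 :: "2 cmat" where
  "J2 = vector [vector [0, 1], vector [-1, 0]]"

definition J4 :: "4 cmat" where
  "J4 = block4 0 (mat 1) (- mat 1) 0"

text \<open>In the index type \<^typ>\<open>5\<close> the numeral \<open>5\<close> equals \<open>0\<close>.\<close>

definition F5 :: "5 \<Rightarrow> 4 cmat" where
  "F5 i = (if i = 1 then kron sigma_x (cscale (- \<i>) sigma_x)
           else if i = 2 then kron sigma_x (cscale (- \<i>) sigma_y)
           else if i = 3 then kron sigma_x (cscale (- \<i>) sigma_z)
           else if i = 4 then kron (cscale \<i> sigma_z) (mat 1)
           else J4)"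

definition V5 :: "4 cmat set" where
  "V5 = span (range F5)"

text \<open>Quaternions as \<^typ>\<open>real^4\<close>, with \<open>1, i, j, k\<close> the standard basis vectors in this order.\<close>

definition qmult :: "real^4 \<Rightarrow> real^4 \<Rightarrow> real^4" where
  "qmult x y = vector
     [x$1 * y$1 - x$2 * y$2 - x$3 * y$3 - x$4 * y$4,
      x$1 * y$2 + x$2 * y$1 + x$3 * y$4 - x$4 * y$3,
      x$1 * y$3 - x$2 * y$4 + x$3 * y$1 + x$4 * y$2,
      x$1 * y$4 + x$2 * y$3 - x$3 * y$2 + x$4 * y$1]"

definition qcnj :: "real^4 \<Rightarrow> real^4" where
  "qcnj x = vector [x$1, - x$2, - x$3, - x$4]"

definition quat_matrix :: "real^4 \<Rightarrow> real^4 \<Rightarrow> real^4^4" where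
  "quat_matrix p q = matrix (\<lambda>x. qmult (qmult p x) (qcnj q))"

definition Jhat4 :: "4 cmat" where
  "Jhat4 = map_matrix complex_of_real (quat_matrix (axis 1 1) (axis 2 1))"

definition Sp4_hat :: "4 cmat set" where
  "Sp4_hat = {X. conj_transpose X ** X = mat 1 \<and> transpose X ** Jhat4 ** X = Jhat4}"

definition sp4_hat :: "4 cmat set" where
  "sp4_hat = {X. conj_transpose X = - X \<and> transpose X ** Jhat4 = - (Jhat4 ** X)}"

definition Spin5 :: "4 cmat set" where
  "Spin5 = Spin V5"

definition Phi5 :: "4 cmat \<Rightarrow> real^5^5" where
  "Phi5 = spin_cover F5"

definition Psi5 :: "4 cmat \<Rightarrow> real^5^5" where
  "Psi5 = linearization Spin5 Phi5"

end

(*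
  The monomials in the generators reduce, modulo the Clifford relations, to signed ordered products
  of distinct generators. A trace argument makes the 32 images in M(4,C) pairwise orthogonal, so they
  form a real basis: this gives Cl(0,5) = M(4,C), the uniqueness of anti-automorphisms with prescribed
  values on 1-vectors, and the fact that only scalars commute with all generators.

  The 1-vectors are cut out by X^* = -X, X^T J = J X and tr X = 0, conditions preserved by
  conjugation with elements of the group, so the last clause in the definition of Spin(5) is
  automatic. A product of two unit 1-vectors covers a product of two reflections, and these generate
  SO(5). No element covers -I, because the volume element F_1 ... F_5 = -i I is central; as 5 is odd,
  this forces determinant 1. The fibres are {X, -X} in a compact group, hence the covering property.

  For the Lie algebra, cos t + sin t F_i F_j is a curve in the group with velocity F_i F_j, and
  -1/4 sum B_kl F_k F_l inverts the map A |-> [A, -] from sp(4) to so(5).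
*)

theory Submission
  imports Defs
begin

section \<open>Complex matrices as a real inner product space\<close>

text \<open>Everything takes place in the 32-dimensional real space of complex 4 by 4 matrices with
  the real part of the trace form. Up to sign the factor i is the product of all five generators,
  which is how real combinations of 2 ^ 5 blades can fill a complex matrix algebra. The obstacle in
  the covering part is the sign of the determinant: a connectedness argument would require the
  topology of the group, so surjectivity onto the rotations is proved before the image is known to
  consist of rotations, and is then used to exclude determinant -1. The Lie algebra part works
  without exponentials: velocities add when curves are multiplied, so it is enough to have curves
  for multiples of products of two generators. These curves also give the linearization its value:
  it is described by a condition on all curves with a given velocity, and without any such curve the
  condition would single out nothing.\<close>

lemma bounded_bilinear_matrix_mult:
  "bounded_bilinear ((**) :: 'a::{euclidean_space,real_algebra_1}^'n^'m \<Rightarrow> 'a^'p^'n \<Rightarrow> 'a^'p^'m)"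
  unfolding bilinear_conv_bounded_bilinear[symmetric] bilinear_def
  by (auto intro!: linearI simp: matrix_add_ldistrib matrix_matrix_mult_def vec_eq_iff
      sum.distrib distrib_right distrib_left scaleR_sum_right)

lemmas matrix_mult_distribs =
  bounded_bilinear.add_left[OF bounded_bilinear_matrix_mult]
  bounded_bilinear.add_right[OF bounded_bilinear_matrix_mult]
  bounded_bilinear.diff_left[OF bounded_bilinear_matrix_mult]
  bounded_bilinear.diff_right[OF bounded_bilinear_matrix_mult]

lemmas matrix_mult_scale =
  bounded_bilinear.minus_left[OF bounded_bilinear_matrix_mult]
  bounded_bilinear.minus_right[OF bounded_bilinear_matrix_mult]
  bounded_bilinear.scaleR_left[OF bounded_bilinear_matrix_mult]
  bounded_bilinear.scaleR_right[OF bounded_bilinear_matrix_mult]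

lemmas matrix_mult_sum_left = bounded_bilinear.sum_left[OF bounded_bilinear_matrix_mult]
lemmas matrix_mult_sum_right = bounded_bilinear.sum_right[OF bounded_bilinear_matrix_mult]

lemma mat_1_neq_0: "(mat 1 :: 'a::zero_neq_one^'n^'n) \<noteq> 0"
proof
  assume "(mat 1 :: 'a^'n^'n) = 0"
  then have "(mat 1 :: 'a^'n^'n) $ undefined $ undefined = 0" by simp
  then show False by (simp add: mat_def)
qed

lemma linear_conj_transpose: "linear (conj_transpose :: 'm::finite cmat \<Rightarrow> 'm cmat)"
  by (auto intro!: linearI simp: conj_transpose_def vec_eq_iff)

lemma linear_transpose: "linear (transpose :: 'a::real_vector^'n^'m \<Rightarrow> 'a^'m^'n)"
  by (auto intro!: linearI simp: transpose_def vec_eq_iff)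

lemma bounded_linear_conj_transpose: "bounded_linear (conj_transpose :: 'm::finite cmat \<Rightarrow> 'm cmat)"
  using linear_conv_bounded_linear linear_conj_transpose by blast

lemma bounded_linear_transpose: "bounded_linear (transpose :: 'm::finite cmat \<Rightarrow> 'm cmat)"
  using linear_conv_bounded_linear linear_transpose by blast

lemma conj_transpose_invol [simp]: "conj_transpose (conj_transpose X) = X"
  by (simp add: conj_transpose_def vec_eq_iff)

lemma conj_transpose_one [simp]: "conj_transpose (mat 1) = mat 1"
  by (auto simp: conj_transpose_def vec_eq_iff mat_def)

lemma conj_transpose_mult:
  "conj_transpose (X ** Y) = conj_transpose Y ** conj_transpose X"
  by (simp add: conj_transpose_def vec_eq_iff matrix_matrix_mult_def mult.commute)

lemmas conj_transpose_linear_simps =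
  linear_add[OF linear_conj_transpose] linear_diff[OF linear_conj_transpose]
  linear_neg[OF linear_conj_transpose] linear_cmul[OF linear_conj_transpose]

lemmas transpose_linear_simps =
  linear_add[OF linear_transpose] linear_diff[OF linear_transpose]
  linear_neg[OF linear_transpose] linear_cmul[OF linear_transpose]

text \<open>The real inner product of nested vectors is the real part of the Hilbert-Schmidt form.
  Orthogonality can thus be read off traces, and multiplication by A has multiplication by A^* as
  its adjoint.\<close>

lemma inner_cmat_eq_trace: "X \<bullet> Y = Re (trace (conj_transpose X ** Y))"
  for X Y :: "'m::finite cmat"
proof -
  have "X \<bullet> Y = (\<Sum>i\<in>UNIV. \<Sum>j\<in>UNIV. Re (cnj (X$i$j) * Y$i$j))"
    by (simp add: inner_vec_def inner_complex_def)
  also have "\<dots> = (\<Sum>j\<in>UNIV. \<Sum>i\<in>UNIV. Re (cnj (X$i$j) * Y$i$j))"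
    by (rule sum.swap)
  also have "\<dots> = Re (trace (conj_transpose X ** Y))"
    by (simp add: trace_def conj_transpose_def matrix_matrix_mult_def)
  finally show ?thesis .
qed

lemma inner_matrix_mult_left: "(A ** X) \<bullet> Y = X \<bullet> (conj_transpose A ** Y)"
  for A X Y :: "'m::finite cmat"
  by (simp add: inner_cmat_eq_trace conj_transpose_mult matrix_mul_assoc)

lemma inner_matrix_mult_right: "(X ** A) \<bullet> Y = X \<bullet> (Y ** conj_transpose A)"
  for A X Y :: "'m::finite cmat"
proof -
  have "trace (conj_transpose A ** (conj_transpose X ** Y)) = trace (conj_transpose X ** Y ** conj_transpose A)"
    by (rule trace_mul_sym)
  then show ?thesis by (simp add: inner_cmat_eq_trace conj_transpose_mult matrix_mul_assoc)
qed

lemma inner_unitary_conj: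
  assumes "conj_transpose G ** G = mat 1"
  shows "(G ** X ** conj_transpose G) \<bullet> (G ** Y ** conj_transpose G) = X \<bullet> Y"
proof -
  have "conj_transpose (G ** X ** conj_transpose G) ** (G ** Y ** conj_transpose G)
      = G ** (conj_transpose X ** (conj_transpose G ** G) ** Y ** conj_transpose G)"
    by (simp add: conj_transpose_mult matrix_mul_assoc)
  also have "trace \<dots> = trace (conj_transpose X ** Y ** (conj_transpose G ** G))"
    by (subst trace_mul_sym) (simp add: assms flip: matrix_mul_assoc)
  finally show ?thesis
    by (simp add: inner_cmat_eq_trace assms)
qed

lemma mat_mult_commute: "mat c ** X = X ** mat c" for X :: "'m::finite cmat"
  by (simp add: vec_eq_iff matrix_matrix_mult_def mat_def if_distrib if_distribR mult.commute cong: if_cong)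

text \<open>Matrix units suffice: for i \<noteq> j the (i,i) entries of X E_ji and E_ji X give X_ij
  = 0, and the (i,j) entries of X E_ij and E_ij X give X_ii = X_jj.\<close>

lemma commuting_with_all_scalar:
  fixes X :: "'m::finite cmat"
  assumes "\<And>Y. X ** Y = Y ** X"
  obtains c where "X = mat c"
proof -
  define E :: "'m \<Rightarrow> 'm \<Rightarrow> 'm cmat" where
    "E = (\<lambda>a b. \<chi> i j. if i = a \<and> j = b then 1 else 0)"
  have L: "(X ** E a b) $ i $ j = (if j = b then X $ i $ a else 0)" for a b i j
    by (cases "j = b") (simp_all add: E_def matrix_matrix_mult_def if_distrib if_distribR cong: if_cong)
  have R: "(E a b ** X) $ i $ j = (if i = a then X $ b $ j else 0)" for a b i j
    by (cases "i = a") (simp_all add: E_def matrix_matrix_mult_def if_distrib if_distribR cong: if_cong)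
  have *: "(if j = b then X $ i $ a else 0) = (if i = a then X $ b $ j else 0)" for a b i j
    using assms[of "E a b"] L[of a b i j] R[of a b i j] by simp
  have "X $ i $ j = 0" if "i \<noteq> j" for i j
    using *[of i i i j] *[of j j i j] that by auto
  moreover have "X $ i $ i = X $ j $ j" for i j
    using *[of j j i i] by simp
  ultimately have "X = mat (X $ undefined $ undefined)"
    by (auto simp: vec_eq_iff mat_def)
  then show ?thesis by (rule that)
qed

section \<open>Continuity and product rule for matrix-valued maps\<close>

lemma continuous_on_matrix_mult [continuous_intros]:
  fixes f g :: "'a::topological_space \<Rightarrow> 'm::finite cmat"
  shows "continuous_on S f \<Longrightarrow> continuous_on S g \<Longrightarrow> continuous_on S (\<lambda>x. f x ** g x)"
  by (rule bounded_bilinear.continuous_on[OF bounded_bilinear_matrix_mult])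

lemma continuous_on_conj_transpose [continuous_intros]:
  fixes f :: "'a::topological_space \<Rightarrow> 'm::finite cmat"
  shows "continuous_on S f \<Longrightarrow> continuous_on S (\<lambda>x. conj_transpose (f x))"
  by (rule bounded_linear.continuous_on[OF bounded_linear_conj_transpose])

lemma continuous_on_transpose [continuous_intros]:
  fixes f :: "'a::topological_space \<Rightarrow> 'm::finite cmat"
  shows "continuous_on S f \<Longrightarrow> continuous_on S (\<lambda>x. transpose (f x))"
  by (rule bounded_linear.continuous_on[OF bounded_linear_transpose])

lemma C1_differentiable_on_matrix_mult:
  fixes f g :: "real \<Rightarrow> 'm::finite cmat"
  assumes "f C1_differentiable_on S" "g C1_differentiable_on S"
  shows "(\<lambda>x. f x ** g x) C1_differentiable_on S"
proof -
  obtain f' g' where f: "\<And>x. x \<in> S \<Longrightarrow> (f has_vector_derivative f' x) (at x)" "continuous_on S f'"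
    and g: "\<And>x. x \<in> S \<Longrightarrow> (g has_vector_derivative g' x) (at x)" "continuous_on S g'"
    using assms unfolding C1_differentiable_on_def by blast
  have cf: "continuous_on S f" and cg: "continuous_on S g"
    using f(1) g(1) by (meson continuous_at_imp_continuous_on has_vector_derivative_continuous)+
  note bb = bounded_bilinear_matrix_mult
  show ?thesis
    unfolding C1_differentiable_on_def
  proof (intro exI conjI ballI)
    show "((\<lambda>x. f x ** g x) has_vector_derivative f x ** g' x + f' x ** g x) (at x)" if "x \<in> S" for x
      by (rule bounded_bilinear.has_vector_derivative[OF bb f(1)[OF that] g(1)[OF that]])
    show "continuous_on S (\<lambda>x. f x ** g' x + f' x ** g x)"
      by (intro continuous_on_add bounded_bilinear.continuous_on[OF bb] cf cg f g)
  qed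
qed

section \<open>Quotient by the antipodal map\<close>

text \<open>Compactness replaces a local inverse: p maps relatively closed subsets of C to closed
  sets, so the image of an open set stable under negation is open, and a small set and its antipode
  become the two sheets over their common image.\<close>

lemma covering_space_mod_sign:
  fixes p :: "'a::euclidean_space \<Rightarrow> 'b::real_normed_vector"
  assumes C: "compact C" "\<And>x. x \<in> C \<Longrightarrow> - x \<in> C" "0 \<notin> C"
    and cont: "continuous_on C p"
    and fib: "\<And>x y. x \<in> C \<Longrightarrow> y \<in> C \<Longrightarrow> p x = p y \<longleftrightarrow> y = x \<or> y = - x"
  shows "covering_space C p (p ` C)"
proof
  have neg: "p (- x) = p x" if "x \<in> C" for x
    using fib[of x "- x"] C(2) that by auto
  have opn: "openin (top_of_set (p ` C)) (p ` u)" if u: "openin (top_of_set C) u" for u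
  proof -
    \<comment> \<open>The saturation of u under negation: the image of u is exactly the complement
      of the image of C - w, which is compact.\<close>
    define w where "w = u \<union> uminus ` u"
    have uC: "u \<subseteq> C" using u openin_imp_subset by blast
    obtain U where U: "open U" "u = C \<inter> U"
      using u by (auto simp: openin_open)
    have "uminus ` u = C \<inter> uminus ` U"
      using U C(2) by (force simp: image_iff)
    then have w: "C - w = C - (U \<union> uminus ` U)"
      using U by (auto simp: w_def)
    have "compact (C - w)"
      unfolding w by (intro compact_diff C open_Un U open_negations)
    then have "compact (p ` (C - w))"
      by (intro compact_continuous_image continuous_on_subset[OF cont]) auto
    moreover have "p ` u = p ` C - p ` (C - w)"
    proof (intro set_eqI iffI)
      fix y assume "y \<in> p ` u"
      then obtain x where x: "x \<in> u" "y = p x" by blast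
      have "z \<in> w" if "z \<in> C" "p z = p x" for z
        using fib[of x z] that x uC by (auto simp: w_def)
      then show "y \<in> p ` C - p ` (C - w)" using x uC by fastforce
    next
      fix y assume "y \<in> p ` C - p ` (C - w)"
      then obtain x where x: "x \<in> w" "x \<in> C" "y = p x" by blast
      then show "y \<in> p ` u" using neg uC by (auto simp: w_def)
    qed
    moreover have "p ` (C - w) \<subseteq> p ` C" by blast
    ultimately show ?thesis
      by (simp add: closed_subset compact_imp_closed openin_diff)
  qed
  show "continuous_on C p" by fact
  show "p ` C = p ` C" ..
  fix y assume "y \<in> p ` C"
  then obtain x where x: "x \<in> C" "y = p x" by blast
  have x0: "x \<noteq> 0" using x C by auto
  \<comment> \<open>The radius is half the distance from x to - x, which keeps the two antipodal
    balls disjoint.\<close>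
  define u where "u = C \<inter> ball x (norm x)"
  define u' where "u' = C \<inter> ball (- x) (norm x)"
  have xu: "x \<in> u" using x x0 by (simp add: u_def)
  have ou: "openin (top_of_set C) u" "openin (top_of_set C) u'"
    by (auto simp: u_def u'_def openin_open)
  have disj: "u \<inter> u' = {}"
  proof -
    have False if "dist x z < norm x" "dist (- x) z < norm x" for z
    proof -
      have "norm (2 *\<^sub>R x) = norm ((x - z) - (- x - z))" by (simp add: scaleR_2)
      also have "\<dots> \<le> norm (x - z) + norm (- x - z)" by (rule norm_triangle_ineq4)
      also have "\<dots> < 2 * norm x" using that by (simp add: dist_norm)
      finally show False by simp
    qed
    then show ?thesis by (auto simp: u_def u'_def)
  qed
  have dneg: "dist (- a) (- b) = dist a b" for a b :: 'a by (simp add: dist_minus)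
  have memu: "- z \<in> u' \<longleftrightarrow> z \<in> u" for z
    using C(2)[of z] C(2)[of "-z"] dneg[of x z] by (auto simp: u_def u'_def)
  then have memu': "- z \<in> u \<longleftrightarrow> z \<in> u'" for z by (metis add.inverse_inverse)
  have sub: "u \<subseteq> C" "u' \<subseteq> C" by (auto simp: u_def u'_def)
  have pu': "p ` u' = p ` u"
  proof (intro equalityI image_subsetI)
    show "p z \<in> p ` u" if "z \<in> u'" for z
      using that neg[of z] memu'[of z] sub by (metis imageI subsetD)
    show "p z \<in> p ` u'" if "z \<in> u" for z
      using that neg[of z] memu[of z] sub by (metis imageI subsetD)
  qed
  have inj: "inj_on p v" if v: "v = u \<or> v = u'" for v
  proof (rule inj_onI)
    fix a b assume "a \<in> v" "b \<in> v" "p a = p b"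
    then have "b = a \<or> b = - a" using fib[of a b] sub v by auto
    moreover have "- a \<notin> v" using \<open>a \<in> v\<close> v memu[of a] memu'[of a] disj by blast
    ultimately show "a = b" using \<open>b \<in> v\<close> by auto
  qed
  have hom: "\<exists>q. homeomorphism v (p ` u) p q" if v: "v = u \<or> v = u'" for v
  proof (rule homeomorphism_injective_open_map)
    show "continuous_on v p" using v sub cont continuous_on_subset by blast
    show "p ` v = p ` u" using v pu' by auto
    show "inj_on p v" by (rule inj[OF v])
    fix t assume t: "openin (top_of_set v) t"
    then have "openin (top_of_set C) t"
      using v openin_trans[OF _ ou(1), of t] openin_trans[OF _ ou(2), of t] by metis
    then have "openin (top_of_set (p ` C)) (p ` t)" by (rule opn)
    moreover have "p ` t \<subseteq> p ` u"
      using t openin_imp_subset \<open>p ` v = p ` u\<close> by blast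
    ultimately show "openin (top_of_set (p ` u)) (p ` t)"
      using openin_subset_trans[of "p ` C" "p ` t" "p ` u"] sub(1) by blast
  qed blast
  have pre: "\<Union>{u, u'} = C \<inter> p -` (p ` u)"
  proof -
    have "z \<in> u \<union> u'" if "z \<in> C" "p z = p a" "a \<in> u" for z a
      using fib[of a z] that sub memu[of a] by auto
    moreover have "p z \<in> p ` u" if "z \<in> u \<union> u'" for z
      using that pu' by blast
    ultimately show ?thesis using sub by auto
  qed
  show "\<exists>T. y \<in> T \<and> openin (top_of_set (p ` C)) T \<and>
          (\<exists>v. \<Union>v = C \<inter> p -` T \<and> (\<forall>u\<in>v. openin (top_of_set C) u) \<and>
            pairwise disjnt v \<and> (\<forall>u\<in>v. \<exists>q. homeomorphism u T p q))"
  proof (intro exI conjI)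
    show "y \<in> p ` u" using x xu by blast
    show "openin (top_of_set (p ` C)) (p ` u)" by (rule opn[OF ou(1)])
    show "\<Union>{u, u'} = C \<inter> p -` (p ` u)" by (rule pre)
    show "\<forall>v\<in>{u, u'}. openin (top_of_set C) v" using ou by blast
    show "pairwise disjnt {u, u'}" using disj by (auto simp: pairwise_def disjnt_def)
    show "\<forall>v\<in>{u, u'}. \<exists>q. homeomorphism v (p ` u) p q" using hom by blast
  qed
qed

section \<open>Normal forms modulo the Clifford relations\<close>

lemma fword_prod_simps [simp]:
  "fword_prod F 0 = mat 1"
  "fword_prod F (FWord []) = mat 1"
  "fword_prod F (FWord (i # u)) = F i ** fword_prod F (FWord u)"
  by (simp_all add: fword_prod_def zero_fword_def)

lemma fword_prod_append:
  "fword_prod F (FWord (u @ v)) = fword_prod F (FWord u) ** fword_prod F (FWord v)"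
  by (induction u) (simp_all add: matrix_mul_assoc)

lemma fword_prod_plus: "fword_prod F (u + v) = fword_prod F u ** fword_prod F v"
  using fword_prod_append[of F "letters u" "letters v"] by (simp add: plus_fword_def)

lemma free_eval_superset:
  assumes "finite A" "Poly_Mapping.keys x \<subseteq> A"
  shows "free_eval F x = (\<Sum>w\<in>A. Poly_Mapping.lookup x w *\<^sub>R fword_prod F w)"
  unfolding free_eval_def using assms
  by (intro sum.mono_neutral_left) (auto simp: in_keys_iff)

lemma free_eval_add: "free_eval F (x + y) = free_eval F x + free_eval F y"
proof -
  let ?A = "Poly_Mapping.keys x \<union> Poly_Mapping.keys y"
  show ?thesis
    using keys_add[of x y]
    by (simp add: free_eval_superset[of ?A] lookup_add scaleR_add_left sum.distrib)
qed

lemma free_eval_single [simp]: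
  "free_eval F (Poly_Mapping.single w c) = c *\<^sub>R fword_prod F w"
  by (simp add: free_eval_superset[of "{w}"])

lemma free_eval_zero [simp]: "free_eval F 0 = 0"
  by (simp add: free_eval_def)

lemma free_eval_uminus: "free_eval F (- x) = - free_eval F x"
  using free_eval_add[of F x "- x"] by (simp add: minus_unique)

lemma free_eval_diff: "free_eval F (x - y) = free_eval F x - free_eval F y"
  using free_eval_add[of F x "- y"] by (simp add: free_eval_uminus)

lemma free_eval_sum: "free_eval F (\<Sum>a\<in>A. f a) = (\<Sum>a\<in>A. free_eval F (f a))"
  by (induction A rule: infinite_finite_induct) (simp_all add: free_eval_add)

lemma free_alg_induct [case_names zero add]:
  assumes "P 0" "\<And>x w c. P x \<Longrightarrow> P (x + Poly_Mapping.single w c)"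
  shows "P x"
proof (induction x rule: update_induct)
  case const
  show ?case by fact
next
  case (update f a b)
  have "Poly_Mapping.update a b f = f + Poly_Mapping.single a b"
    using update(1) by (intro poly_mapping_eqI)
      (auto simp: lookup_update lookup_add lookup_single when_def in_keys_iff)
  then show ?case using assms(2) update by simp
qed

lemma free_eval_mult: "free_eval F (x * y) = free_eval F x ** free_eval F y"
proof (induction x rule: free_alg_induct)
  case (add x w c)
  have "free_eval F (Poly_Mapping.single w c * y) = (c *\<^sub>R fword_prod F w) ** free_eval F y"
    by (induction y rule: free_alg_induct)
      (simp_all add: distrib_left free_eval_add mult_single fword_prod_plus
        matrix_mult_distribs matrix_mult_scale mult.commute)
  then show ?case
    using add by (simp add: distrib_right free_eval_add matrix_mult_distribs)
qed simp

section \<open>Rewriting words modulo the ideal of the Clifford relations\<close>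

lemma two_sided_ideal_trans:
  assumes "x - y \<in> two_sided_ideal R" "y - z \<in> two_sided_ideal R"
  shows "x - z \<in> two_sided_ideal R"
  using two_sided_ideal.plus[OF assms] by simp

abbreviation (input) word_term :: "'i list \<Rightarrow> real \<Rightarrow> 'i free_alg" where
  "word_term u c \<equiv> Poly_Mapping.single (FWord u) c"

lemma word_term_mult: "word_term u a * word_term v b = word_term (u @ v) (a * b)"
  by (simp add: mult_single plus_fword_def)

lemma clifford_ideal_swap:
  assumes "i \<noteq> j"
  shows "word_term (i # j # u) c - word_term (j # i # u) (- c) \<in> two_sided_ideal (clifford_relators \<eta>)"
proof -
  let ?r = "free_gen i * free_gen j + free_gen j * free_gen i"
  have "?r \<in> two_sided_ideal (clifford_relators \<eta>)"
    using assms by (intro two_sided_ideal.base) (auto simp: clifford_relators_def)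
  then have "?r * word_term u c \<in> two_sided_ideal (clifford_relators \<eta>)"
    by (rule two_sided_ideal.right)
  then show ?thesis
    by (simp add: free_gen_def word_term_mult distrib_right single_uminus)
qed

lemma clifford_ideal_square:
  "word_term (i # i # u) c - word_term u (\<eta> i * c) \<in> two_sided_ideal (clifford_relators \<eta>)"
proof -
  let ?r = "free_gen i * free_gen i - free_const (\<eta> i)"
  have "?r \<in> two_sided_ideal (clifford_relators \<eta>)"
    by (intro two_sided_ideal.base) (auto simp: clifford_relators_def)
  then have "?r * word_term u c \<in> two_sided_ideal (clifford_relators \<eta>)"
    by (rule two_sided_ideal.right)
  then show ?thesis
    by (simp add: free_gen_def free_const_def zero_fword_def word_term_mult left_diff_distrib)
qed

text \<open>The swap and square congruences act on the first letters of a word, being relators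
  multiplied on the right; left multiplication carries them behind any prefix.\<close>

lemma two_sided_ideal_Cons:
  assumes "word_term u a - word_term v b \<in> two_sided_ideal R"
  shows "word_term (i # u) a - word_term (i # v) b \<in> two_sided_ideal R"
  using two_sided_ideal.left[OF assms, of "word_term [i] 1"]
  by (simp add: right_diff_distrib word_term_mult)

lemma two_sided_ideal_scale:
  assumes "word_term u a - word_term v b \<in> two_sided_ideal R"
  shows "word_term u (c * a) - word_term v (c * b) \<in> two_sided_ideal R"
  using two_sided_ideal.left[OF assms, of "word_term [] c"]
  by (simp add: right_diff_distrib word_term_mult)

text \<open>The symmetric difference with {i}: the effect of multiplying a product of distinct
  generators by the generator i, up to sign and order.\<close>

definition toggle :: "'i \<Rightarrow> 'i set \<Rightarrow> 'i set" where
  "toggle i S = (if i \<in> S then S - {i} else insert i S)"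

text \<open>Swapping letters and cancelling equal pairs preserve every parity, so this set is the
  invariant that determines the normal form of a word up to sign.\<close>

definition odd_letters :: "'i list \<Rightarrow> 'i set" where
  "odd_letters u = {i. odd (count_list u i)}"

lemma odd_letters_simps [simp]:
  "odd_letters [] = {}"
  "odd_letters (i # u) = toggle i (odd_letters u)"
  by (auto simp: odd_letters_def toggle_def)

lemma odd_letters_distinct: "distinct u \<Longrightarrow> odd_letters u = set u"
  by (induction u) (auto simp: toggle_def)

text \<open>The odd letters of the concatenation form the symmetric difference of the two sets. This
  is what separates distinct blades later.\<close>

lemma odd_letters_rev_append:
  assumes "distinct u" "distinct v" "odd_letters (rev u @ v) = {}"
  shows "set u = set v"
proof -
  have odd: "i \<in> set w \<longleftrightarrow> odd (count_list w i)" if "distinct w" for w i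
    using odd_letters_distinct[OF that] by (auto simp: odd_letters_def)
  show ?thesis
    using assms(3) by (auto simp: odd[OF assms(1)] odd[OF assms(2)] odd_letters_def)
qed

text \<open>An insertion sort: i moves right through the letters of l that lie in S, each swap
  changing the sign, until its own place is reached. There it stays if i \<notin> S, and otherwise
  cancels against its copy with the factor \<eta> i.\<close>

lemma insert_letter_mod_clifford_ideal:
  assumes "range \<eta> \<subseteq> {1, -1}" "distinct l" "i \<in> set l"
  shows "\<exists>s\<in>{1, -1}. word_term (i # filter (\<lambda>j. j \<in> S) l) 1
            - word_term (filter (\<lambda>j. j \<in> toggle i S) l) s \<in> two_sided_ideal (clifford_relators \<eta>)"
  using assms(2,3)
proof (induction l)
  case (Cons a l)
  let ?I = "two_sided_ideal (clifford_relators \<eta>)"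
  show ?case
  proof (cases "a = i")
    case True
    then have eq: "filter (\<lambda>j. j \<in> toggle i S) l = filter (\<lambda>j. j \<in> S) l"
      using Cons.prems by (intro filter_cong) (auto simp: toggle_def)
    show ?thesis
    proof (cases "i \<in> S")
      case True
      have "\<eta> i \<in> {1, -1}" using assms(1) by auto
      moreover have "toggle i S = S - {i}" using True by (simp add: toggle_def)
      moreover have "word_term (i # i # filter (\<lambda>j. j \<in> S) l) 1
          - word_term (filter (\<lambda>j. j \<in> S) l) (\<eta> i) \<in> ?I"
        using clifford_ideal_square[of i "filter (\<lambda>j. j \<in> S) l" 1 \<eta>] by simp
      ultimately show ?thesis
        using eq \<open>a = i\<close> True by (intro bexI[of _ "\<eta> i"]) simp_all
    next
      case False
      then have "i \<in> toggle i S" by (simp add: toggle_def)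
      then show ?thesis
        using eq \<open>a = i\<close> False by (intro bexI[of _ 1]) (simp_all add: two_sided_ideal.zero)
    qed
  next
    case False
    then have mem: "a \<in> toggle i S \<longleftrightarrow> a \<in> S" by (auto simp: toggle_def)
    obtain s where s: "s \<in> {1, -1}"
      "word_term (i # filter (\<lambda>j. j \<in> S) l) 1 - word_term (filter (\<lambda>j. j \<in> toggle i S) l) s \<in> ?I"
      using Cons False by auto
    show ?thesis
    proof (cases "a \<in> S")
      case True
      have "word_term (i # a # filter (\<lambda>j. j \<in> S) l) 1 - word_term (a # i # filter (\<lambda>j. j \<in> S) l) (- 1) \<in> ?I"
        using clifford_ideal_swap[of i a] False by fastforce
      moreover have "word_term (a # i # filter (\<lambda>j. j \<in> S) l) (- 1)
          - word_term (a # filter (\<lambda>j. j \<in> toggle i S) l) (- s) \<in> ?I"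
        using two_sided_ideal_scale[OF two_sided_ideal_Cons[OF s(2)], of a "-1"] by simp
      ultimately have "word_term (i # a # filter (\<lambda>j. j \<in> S) l) 1
          - word_term (a # filter (\<lambda>j. j \<in> toggle i S) l) (- s) \<in> ?I"
        by (rule two_sided_ideal_trans)
      then show ?thesis
        using True mem s(1) by (intro bexI[of _ "- s"]) auto
    qed (use mem s in auto)
  qed
qed simp

lemma word_mod_clifford_ideal:
  assumes "range \<eta> \<subseteq> {1, -1}" "distinct l" "set l = UNIV"
  shows "\<exists>s\<in>{1, -1}. word_term u 1 - word_term (filter (\<lambda>j. j \<in> odd_letters u) l) s
            \<in> two_sided_ideal (clifford_relators \<eta>)"
proof (induction u)
  case (Cons i u)
  let ?I = "two_sided_ideal (clifford_relators \<eta>)"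
  obtain s where s: "s \<in> {1, -1}"
    "word_term u 1 - word_term (filter (\<lambda>j. j \<in> odd_letters u) l) s \<in> ?I"
    using Cons by blast
  obtain t where t: "t \<in> {1, -1}" "word_term (i # filter (\<lambda>j. j \<in> odd_letters u) l) 1
      - word_term (filter (\<lambda>j. j \<in> toggle i (odd_letters u)) l) t \<in> ?I"
    using insert_letter_mod_clifford_ideal[of \<eta> l i "odd_letters u"] assms by auto
  have "word_term (i # u) 1
      - word_term (filter (\<lambda>j. j \<in> toggle i (odd_letters u)) l) (s * t) \<in> ?I"
    using two_sided_ideal_trans[OF two_sided_ideal_Cons[OF s(2)], of i]
      two_sided_ideal_scale[OF t(2), of s] by simp
  then show ?case using s(1) t(1) by (intro bexI[of _ "s * t"]) auto
qed (auto simp: zero_fword_def intro: two_sided_ideal.zero)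

text \<open>Every word reduces to a term indexed by a subset, so this is the upper bound 2 ^ n on
  the dimension of the Clifford algebra with n generators.\<close>

lemma free_alg_normal_form:
  fixes \<eta> :: "'i::finite \<Rightarrow> real"
  assumes "range \<eta> \<subseteq> {1, -1}" "distinct l" "set l = UNIV"
  shows "\<exists>c. x - (\<Sum>S\<in>UNIV. word_term (filter (\<lambda>j. j \<in> S) l) (c S))
            \<in> two_sided_ideal (clifford_relators \<eta>)"
proof (induction x rule: free_alg_induct)
  case zero
  have "(0::'i free_alg) - (\<Sum>S\<in>UNIV. word_term (filter (\<lambda>j. j \<in> S) l) 0)
      \<in> two_sided_ideal (clifford_relators \<eta>)"
    by (simp add: two_sided_ideal.zero)
  then show ?case by (rule exI[of _ "\<lambda>_. 0"])
next
  case (add x w d)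
  let ?I = "two_sided_ideal (clifford_relators \<eta>)"
  let ?n = "\<lambda>S a. word_term (filter (\<lambda>j. j \<in> S) l) a"
  obtain c where c: "x - (\<Sum>S\<in>UNIV. ?n S (c S)) \<in> ?I" using add by blast
  obtain u where u: "w = FWord u" by (cases w)
  define T where "T = odd_letters u"
  obtain s where "word_term u 1 - ?n T s \<in> ?I"
    using word_mod_clifford_ideal[OF assms, of u] unfolding T_def by blast
  then have "word_term u d - ?n T (d * s) \<in> ?I"
    using two_sided_ideal_scale[of u 1 _ s _ d] by simp
  moreover have "(\<Sum>S\<in>UNIV. ?n S (c S + (if S = T then d * s else 0)))
      = (\<Sum>S\<in>UNIV. ?n S (c S)) + ?n T (d * s)"
  proof -
    have "(\<Sum>S\<in>UNIV. ?n S (if S = T then d * s else 0)) = (\<Sum>S\<in>UNIV. if S = T then ?n T (d * s) else 0)"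
      by (intro sum.cong) auto
    then show ?thesis by (simp add: single_add sum.distrib)
  qed
  ultimately have "x + word_term u d - (\<Sum>S\<in>UNIV. ?n S (c S + (if S = T then d * s else 0))) \<in> ?I"
    using two_sided_ideal.plus[OF c, of "word_term u d - ?n T (d * s)"]
    by (simp add: algebra_simps)
  then show ?case unfolding u by (rule exI[of _ "\<lambda>S. c S + (if S = T then d * s else 0)"])
qed

lemma two_sided_ideal_subset_kernel:
  assumes "\<And>i j. i \<noteq> j \<Longrightarrow> F i ** F j = - (F j ** F i)"
    and "\<And>i. F i ** F i = \<eta> i *\<^sub>R mat 1"
    and "x \<in> two_sided_ideal (clifford_relators \<eta>)"
  shows "free_eval F x = 0"
  using assms(3)
proof induction
  case (base r)
  show ?case
  proof -
    from base consider i j where "i \<noteq> j" "r = free_gen i * free_gen j + free_gen j * free_gen i"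
      | i where "r = free_gen i * free_gen i - free_const (\<eta> i)"
      by (auto simp: clifford_relators_def)
    then show ?thesis
    proof cases
      case 1
      then show ?thesis
        using assms(1)[of i j] by (simp add: free_eval_add free_eval_mult free_gen_def)
    next
      case 2
      then show ?thesis
        by (simp add: free_eval_diff free_eval_mult free_gen_def free_const_def assms(2))
    qed
  qed
qed (simp_all add: free_eval_add free_eval_mult)

section \<open>Bases of 1-vectors of matrix algebras\<close>

lemma fword_prod_commute_sign:
  assumes anti: "\<And>i j. i \<noteq> j \<Longrightarrow> F i ** F j = - (F j ** F i)"
  shows "F i ** fword_prod F (FWord u)
      = (- 1) ^ length (filter (\<lambda>j. j \<noteq> i) u) *\<^sub>R (fword_prod F (FWord u) ** F i)"
proof (induction u)
  case (Cons a u)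
  show ?case
  proof (cases "a = i")
    case False
    then have "F i ** (F a ** fword_prod F (FWord u)) = - (F a ** (F i ** fword_prod F (FWord u)))"
      using anti[of i a] by (simp add: matrix_mul_assoc matrix_mult_scale)
    then show ?thesis
      using False by (simp add: Cons matrix_mult_scale matrix_mul_assoc)
  qed (simp add: Cons matrix_mult_scale matrix_mul_assoc)
qed simp

text \<open>The list \<open>l\<close> fixes the order in which generators are multiplied, and
  \<open>adjoint\<close> makes them unitary. With an odd number of generators their full product
  commutes with each of them, so anticommutation leaves its trace open; \<open>top_trace\<close>
  supplies it.\<close>

locale clifford_matrices =
  fixes F :: "'i::finite \<Rightarrow> 'm::finite cmat" and \<eta> :: "'i \<Rightarrow> real" and l :: "'i list"
  assumes eta: "range \<eta> \<subseteq> {1, -1}"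
    and anti: "\<And>i j. i \<noteq> j \<Longrightarrow> F i ** F j = - (F j ** F i)"
    and square: "\<And>i. F i ** F i = \<eta> i *\<^sub>R mat 1"
    and adjoint: "\<And>i. conj_transpose (F i) = \<eta> i *\<^sub>R F i"
    and l: "distinct l" "set l = UNIV"
    and top_trace: "Re (trace (fword_prod F (FWord l))) = 0"
begin

abbreviation blade :: "'i set \<Rightarrow> 'm cmat" where
  "blade S \<equiv> fword_prod F (FWord (filter (\<lambda>j. j \<in> S) l))"

lemma eta_cases: "\<eta> i = 1 \<or> \<eta> i = - 1"
  using eta by auto

text \<open>For a nonempty proper subset some generator anticommutes with the blade: one inside it if its
  size is even, one outside it if its size is odd.\<close>

lemma trace_blade:
  assumes "S \<noteq> {}"
  shows "Re (trace (blade S)) = 0"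
proof (cases "S = UNIV")
  case True
  then show ?thesis using top_trace by simp
next
  case False
  obtain i where i: "odd (card (S - {i}))"
  proof (cases "even (card S)")
    case True
    obtain i where "i \<in> S" using assms by blast
    then have "Suc (card (S - {i})) = card S" by (intro card_Suc_Diff1) auto
    with True have "odd (card (S - {i}))" by presburger
    then show ?thesis by (rule that)
  next
    case odd: False
    obtain i where "i \<notin> S" using False by blast
    then show ?thesis using odd that[of i] by simp
  qed
  let ?M = "blade S"
  have "length (filter (\<lambda>j. j \<noteq> i) (filter (\<lambda>j. j \<in> S) l)) = card (S - {i})"
    using l by (subst distinct_card[symmetric]) (auto intro!: arg_cong[where f = card])
  then have "F i ** ?M = - (?M ** F i)"
    using fword_prod_commute_sign[of F i, OF anti] i by simp
  then have "F i ** ?M ** F i = - (?M ** (F i ** F i))"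
    by (simp add: matrix_mult_scale matrix_mul_assoc)
  then have "trace (F i ** (?M ** F i)) = trace (- (\<eta> i *\<^sub>R ?M))"
    by (simp add: square matrix_mult_scale matrix_mul_assoc)
  moreover have "trace (F i ** (?M ** F i)) = trace (?M ** (F i ** F i))"
    by (subst trace_mul_sym) (simp add: matrix_mul_assoc)
  ultimately have "trace (\<eta> i *\<^sub>R ?M) = trace (- (\<eta> i *\<^sub>R ?M))"
    by (simp add: square matrix_mult_scale)
  then have "\<eta> i *\<^sub>R trace ?M = - (\<eta> i *\<^sub>R trace ?M)"
    by (simp add: trace_def scaleR_sum_right sum_negf)
  then show ?thesis using eta_cases[of i] by (auto simp: complex_eq_iff)
qed

lemma word_eq_blade: "\<exists>s\<in>{1, -1}. fword_prod F (FWord u) = s *\<^sub>R blade (odd_letters u)"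
proof -
  obtain s where s: "s \<in> {1, -1}" "word_term u 1 - word_term (filter (\<lambda>j. j \<in> odd_letters u) l) s
      \<in> two_sided_ideal (clifford_relators \<eta>)"
    using word_mod_clifford_ideal[OF eta l, of u] by blast
  then show ?thesis
    using two_sided_ideal_subset_kernel[OF anti square s(2)]
    by (intro bexI[of _ s]) (simp_all add: free_eval_diff)
qed

lemma conj_transpose_word:
  "\<exists>s\<in>{1, -1}. conj_transpose (fword_prod F (FWord u)) = s *\<^sub>R fword_prod F (FWord (rev u))"
proof (induction u)
  case (Cons i u)
  then obtain s where s: "s \<in> {1, -1}"
    "conj_transpose (fword_prod F (FWord u)) = s *\<^sub>R fword_prod F (FWord (rev u))" by blast
  then have "conj_transpose (fword_prod F (FWord (i # u)))
      = (\<eta> i * s) *\<^sub>R fword_prod F (FWord (rev (i # u)))"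
    by (simp add: conj_transpose_mult adjoint fword_prod_append matrix_mult_scale)
  then show ?case using s(1) eta_cases[of i] by (intro bexI[of _ "\<eta> i * s"]) auto
qed (auto intro: bexI[of _ 1])

text \<open>The adjoint of a word is its reversal up to sign, so the adjoint of one blade times the
  other is, up to sign, the blade of the symmetric difference, whose trace has real part
  zero.\<close>

lemma blade_orthogonal:
  assumes "S \<noteq> T"
  shows "blade S \<bullet> blade T = 0"
proof -
  let ?u = "filter (\<lambda>j. j \<in> S) l" and ?v = "filter (\<lambda>j. j \<in> T) l"
  obtain s where s: "conj_transpose (blade S) = s *\<^sub>R fword_prod F (FWord (rev ?u))"
    using conj_transpose_word by blast
  obtain t where t: "fword_prod F (FWord (rev ?u @ ?v)) = t *\<^sub>R blade (odd_letters (rev ?u @ ?v))"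
    using word_eq_blade by blast
  have "conj_transpose (blade S) ** blade T = (s * t) *\<^sub>R blade (odd_letters (rev ?u @ ?v))"
    using s t by (simp add: fword_prod_append matrix_mult_scale)
  moreover have "odd_letters (rev ?u @ ?v) \<noteq> {}"
    using odd_letters_rev_append[of ?u ?v] l assms by auto
  ultimately show ?thesis
    using trace_blade by (simp add: inner_cmat_eq_trace trace_def flip: scaleR_sum_right)
qed

lemma word_invertible: "\<exists>Y. Y ** fword_prod F (FWord u) = mat 1"
proof (induction u)
  case Nil
  then show ?case by (auto intro: exI[of _ "mat 1"])
next
  case (Cons i u)
  then obtain Y where Y: "Y ** fword_prod F (FWord u) = mat 1" by blast
  have "(\<eta> i *\<^sub>R (Y ** F i)) ** fword_prod F (FWord (i # u))
      = \<eta> i *\<^sub>R (Y ** (F i ** F i) ** fword_prod F (FWord u))"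
    by (simp add: matrix_mult_scale matrix_mul_assoc)
  also have "\<dots> = mat 1"
    using eta_cases[of i] Y by (auto simp: square matrix_mult_scale)
  finally show ?case by blast
qed

lemma blade_nonzero: "blade S \<noteq> 0"
proof
  assume "blade S = 0"
  then have "(mat 1 :: 'm cmat) = 0"
    using word_invertible[of "filter (\<lambda>j. j \<in> S) l"] by auto
  then show False using mat_1_neq_0 by blast
qed

lemma inj_blade: "inj blade"
proof (rule injI)
  fix S T assume "blade S = blade T"
  then show "S = T"
    using blade_orthogonal[of S T] blade_nonzero[of T] by (metis inner_eq_zero_iff)
qed

lemma blade_combination_eq_0:
  assumes "(\<Sum>S\<in>UNIV. c S *\<^sub>R blade S) = 0"
  shows "c T = 0"
proof -
  have "0 = (\<Sum>S\<in>UNIV. c S *\<^sub>R blade S) \<bullet> blade T" using assms by simp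
  also have "\<dots> = (\<Sum>S\<in>UNIV. if S = T then c T * (blade T \<bullet> blade T) else 0)"
    unfolding inner_sum_left by (intro sum.cong) (auto simp: blade_orthogonal)
  finally show ?thesis using blade_nonzero by simp
qed

text \<open>Relators evaluate to zero by the Clifford relations. Conversely, an element of the
  kernel is congruent to a combination of normal forms, and independence of the blades kills all its
  coefficients.\<close>

lemma kernel_free_eval: "{x. free_eval F x = 0} = two_sided_ideal (clifford_relators \<eta>)"
proof (intro set_eqI iffI)
  fix x assume "x \<in> {x. free_eval F x = 0}"
  then have x: "free_eval F x = 0" by simp
  obtain c where c: "x - (\<Sum>S\<in>UNIV. word_term (filter (\<lambda>j. j \<in> S) l) (c S))
      \<in> two_sided_ideal (clifford_relators \<eta>)"
    using free_alg_normal_form[OF eta l] by blast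
  have "(\<Sum>S\<in>UNIV. c S *\<^sub>R blade S) = 0"
    using two_sided_ideal_subset_kernel[OF anti square c] x
    by (simp add: free_eval_diff free_eval_sum)
  then have "c = (\<lambda>_. 0)" using blade_combination_eq_0 by blast
  then show "x \<in> two_sided_ideal (clifford_relators \<eta>)" using c by simp
qed (auto intro: two_sided_ideal_subset_kernel[OF anti square])

text \<open>The hypothesis equates the number of subsets with the real dimension of the matrix
  algebra, so the orthogonal blades are a basis.\<close>

lemma span_blade:
  assumes "2 ^ CARD('i) = 2 * CARD('m)\<^sup>2"
  shows "span (range blade) = UNIV"
proof -
  have "pairwise orthogonal (range blade)"
  proof (rule pairwiseI)
    fix X Y assume "X \<in> range blade" "Y \<in> range blade" "X \<noteq> Y"
    then obtain S T where "X = blade S" "Y = blade T" "S \<noteq> T" by blast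
    then show "orthogonal X Y" using blade_orthogonal[of S T] by (simp add: orthogonal_def)
  qed
  then have "independent (range blade)"
    using blade_nonzero by (intro pairwise_orthogonal_independent) auto
  moreover have "card (range blade) = DIM('m cmat)"
    using assms by (simp add: card_image[OF inj_blade] card_UNIV_set power2_eq_square)
  ultimately show ?thesis
    by (metis dim_eq_card_independent dim_eq_full)
qed

lemma surj_free_eval:
  assumes "2 ^ CARD('i) = 2 * CARD('m)\<^sup>2"
  shows "surj (free_eval F)"
proof -
  have "subspace (range (free_eval F))"
  proof (rule subspaceI)
    show "0 \<in> range (free_eval F)" by (metis free_eval_zero rangeI)
    show "x + y \<in> range (free_eval F)" if "x \<in> range (free_eval F)" "y \<in> range (free_eval F)" for x y
      using that by (auto simp flip: free_eval_add)
    show "c *\<^sub>R x \<in> range (free_eval F)" if x: "x \<in> range (free_eval F)" for c x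
    proof -
      obtain y where "x = free_eval F y" using x by blast
      then have "c *\<^sub>R x = free_eval F (free_const c * y)"
        by (simp add: free_eval_mult free_const_def matrix_mult_scale)
      then show ?thesis by blast
    qed
  qed
  moreover have "range blade \<subseteq> range (free_eval F)"
  proof (rule image_subsetI)
    fix S
    have "blade S = free_eval F (word_term (filter (\<lambda>j. j \<in> S) l) 1)" by simp
    then show "blade S \<in> range (free_eval F)" by (rule range_eqI)
  qed
  ultimately have "span (range blade) \<subseteq> range (free_eval F)"
    by (rule span_minimal[rotated])
  then show ?thesis using span_blade[OF assms] by auto
qed

lemma one_vector_basis:
  assumes "2 ^ CARD('i) = 2 * CARD('m)\<^sup>2"
    and "card {i. \<eta> i = 1} = p" "card {i. \<eta> i = -1} = q"
  shows "one_vector_basis p q F"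
  unfolding one_vector_basis_def
  using eta anti square kernel_free_eval surj_free_eval assms by (intro exI[of _ \<eta>]) blast

end

text \<open>Generation by the matrices \<open>F i\<close> in the form of an induction rule; sums and
  real multiples share the single case \<open>lin\<close>.\<close>

lemma surj_free_eval_induct [consumes 1, case_names one mult lin]:
  assumes "surj (free_eval F)"
    and "P (mat 1)"
    and "\<And>i X. P X \<Longrightarrow> P (F i ** X)"
    and "\<And>X Y c. P X \<Longrightarrow> P Y \<Longrightarrow> P (X + c *\<^sub>R Y)"
  shows "P X"
proof -
  have w: "P (fword_prod F (FWord u))" for u
    by (induction u) (auto intro: assms)
  have "P (free_eval F x)" for x
  proof (induction x rule: free_alg_induct)
    case zero
    \<comment> \<open>Zero arises as \<open>mat 1\<close> minus itself.\<close>
    show ?case using assms(4)[OF assms(2) assms(2), of "-1"] by simp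
  next
    case (add x w c)
    show ?case using assms(4)[OF add w[of "letters w"], of c] by (simp add: free_eval_add)
  qed
  then show ?thesis using assms(1) by (metis surjD)
qed

section \<open>Consequences of generation by the 1-vectors\<close>

lemma anti_automorphism_unique:
  assumes F: "surj (free_eval F)"
    and "anti_automorphism \<phi>" "anti_automorphism \<psi>"
    and "\<phi> (mat 1) = mat 1" "\<psi> (mat 1) = mat 1" "\<And>i. \<phi> (F i) = \<psi> (F i)"
  shows "\<phi> = \<psi>"
proof
  fix X
  have lin: "linear \<phi>" "linear \<psi>" and mult: "\<And>X Y. \<phi> (X ** Y) = \<phi> Y ** \<phi> X"
      "\<And>X Y. \<psi> (X ** Y) = \<psi> Y ** \<psi> X"
    using assms by (auto simp: anti_automorphism_def)
  show "\<phi> X = \<psi> X"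
    using F by (induction X rule: surj_free_eval_induct)
      (simp_all add: assms mult linear_add[OF lin(1)] linear_add[OF lin(2)]
        linear_cmul[OF lin(1)] linear_cmul[OF lin(2)])
qed

lemma commutes_with_generators:
  assumes "surj (free_eval F)" "\<And>i. X ** F i = F i ** X"
  shows "X ** Y = Y ** X"
  using assms(1)
proof (induction Y rule: surj_free_eval_induct)
  case (mult i Y)
  then show ?case by (metis assms(2) matrix_mul_assoc)
qed (simp_all add: matrix_mult_distribs matrix_mult_scale)

section \<open>The generators of Cl(0,5)\<close>

lemma exhaust_5:
  fixes x :: 5
  shows "x = 0 \<or> x = 1 \<or> x = 2 \<or> x = 3 \<or> x = 4"
proof (induct x)
  case (of_int z)
  then have "z = 0 \<or> z = 1 \<or> z = 2 \<or> z = 3 \<or> z = 4" by fastforce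
  then show ?case by auto
qed

lemma forall_5: "(\<forall>i::5. P i) \<longleftrightarrow> P 0 \<and> P 1 \<and> P 2 \<and> P 3 \<and> P 4"
  by (metis exhaust_5)

lemma UNIV_5: "UNIV = {0, 1, 2, 3, 4::5}"
  using exhaust_5 by auto

lemma sum_5: "sum f (UNIV::5 set) = f 0 + f 1 + f 2 + f 3 + f 4"
  unfolding UNIV_5 by (simp add: ac_simps)

lemma vector_4 [simp]:
  "(vector [w, x, y, z] :: 'a::zero^4) $ 1 = w"
  "(vector [w, x, y, z] :: 'a::zero^4) $ 2 = x"
  "(vector [w, x, y, z] :: 'a::zero^4) $ 3 = y"
  "(vector [w, x, y, z] :: 'a::zero^4) $ 4 = z"
  unfolding vector_def by simp_all

text \<open>Index 0 is the fifth generator \<open>J4\<close>. With all entries written out, every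
  identity among the generators becomes a finite computation.\<close>

lemma F5_explicit:
  "F5 0 = vector [vector [0, 0, 1, 0], vector [0, 0, 0, 1], vector [-1, 0, 0, 0], vector [0, -1, 0, 0]]"
  "F5 1 = vector [vector [0, 0, 0, -\<i>], vector [0, 0, -\<i>, 0], vector [0, -\<i>, 0, 0], vector [-\<i>, 0, 0, 0]]"
  "F5 2 = vector [vector [0, 0, 0, -1], vector [0, 0, 1, 0], vector [0, -1, 0, 0], vector [1, 0, 0, 0]]"
  "F5 3 = vector [vector [0, 0, -\<i>, 0], vector [0, 0, 0, \<i>], vector [-\<i>, 0, 0, 0], vector [0, \<i>, 0, 0]]"
  "F5 4 = vector [vector [\<i>, 0, 0, 0], vector [0, \<i>, 0, 0], vector [0, 0, -\<i>, 0], vector [0, 0, 0, -\<i>]]"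
  by (simp_all add: vec_eq_iff forall_4 F5_def kron_def J4_def block4_def cscale_def map_matrix_def
      sigma_x_def sigma_y_def sigma_z_def blk_def pos_def mat_def)

text \<open>Right multiplication by the conjugate of i sends 1, i, j, k to -i, 1, k, -j, which are
  the columns.\<close>

lemma Jhat4_explicit:
  "Jhat4 = vector [vector [0, 1, 0, 0], vector [-1, 0, 0, 0], vector [0, 0, 0, -1], vector [0, 0, 1, 0]]"
  by (simp add: vec_eq_iff forall_4 Jhat4_def quat_matrix_def matrix_def qmult_def qcnj_def
      map_matrix_def axis_def)

lemma Jhat4_eq_block4: "Jhat4 = block4 J2 0 0 (- J2)"
  by (simp add: vec_eq_iff forall_4 Jhat4_explicit block4_def blk_def pos_def J2_def)

lemma Jhat4_square: "Jhat4 ** Jhat4 = - mat 1"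
  by (simp add: Jhat4_explicit vec_eq_iff forall_4 matrix_matrix_mult_def sum_4 mat_def)

lemma transpose_Jhat4: "transpose Jhat4 = - Jhat4"
  by (simp add: Jhat4_explicit vec_eq_iff forall_4 transpose_def)

lemma invertible_Jhat4: "invertible Jhat4"
  unfolding invertible_def
  by (rule exI[of _ "- Jhat4"]) (simp add: matrix_mult_scale Jhat4_square)

lemma matrix_inv_Jhat4: "matrix_inv Jhat4 = - Jhat4"
proof -
  have "Jhat4 ** (- Jhat4) = mat 1 \<and> (- Jhat4) ** Jhat4 = mat 1"
    by (simp add: matrix_mult_scale Jhat4_square)
  \<comment> \<open>\<open>matrix_inv\<close> is a choice among two-sided inverses: the witness
    gives its defining property, and cancelling \<open>Jhat4\<close> then gives its value.\<close>
  then have "Jhat4 ** matrix_inv Jhat4 = mat 1 \<and> matrix_inv Jhat4 ** Jhat4 = mat 1"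
    unfolding matrix_inv_def by (rule someI)
  then have "(- Jhat4) ** (Jhat4 ** matrix_inv Jhat4) = - Jhat4" by simp
  then show ?thesis by (simp add: matrix_mul_assoc matrix_mult_scale Jhat4_square)
qed

section \<open>Algebraic relations among the generators\<close>

lemma F5_anticommute: "i \<noteq> j \<Longrightarrow> F5 i ** F5 j = - (F5 j ** F5 i)"
proof -
  have "\<forall>i j. i \<noteq> j \<longrightarrow> F5 i ** F5 j = - (F5 j ** F5 i)"
    by (simp add: forall_5 F5_explicit)
      (simp add: vec_eq_iff forall_4 matrix_matrix_mult_def sum_4)
  then show "i \<noteq> j \<Longrightarrow> F5 i ** F5 j = - (F5 j ** F5 i)" by blast
qed

lemma F5_square: "F5 i ** F5 i = - mat 1"
proof -
  have "\<forall>i. F5 i ** F5 i = - mat 1"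
    by (simp add: forall_5 F5_explicit vec_eq_iff forall_4 matrix_matrix_mult_def sum_4 mat_def)
  then show ?thesis by blast
qed

lemma conj_transpose_F5: "conj_transpose (F5 i) = - F5 i"
proof -
  have "\<forall>i. conj_transpose (F5 i) = - F5 i"
    by (simp add: forall_5 F5_explicit vec_eq_iff forall_4 conj_transpose_def)
  then show ?thesis by blast
qed

lemma transpose_F5_Jhat4: "transpose (F5 i) ** Jhat4 = Jhat4 ** F5 i"
proof -
  have "\<forall>i. transpose (F5 i) ** Jhat4 = Jhat4 ** F5 i"
    by (simp add: forall_5 F5_explicit Jhat4_explicit vec_eq_iff forall_4 transpose_def
        matrix_matrix_mult_def sum_4)
  then show ?thesis by blast
qed

lemma trace_F5: "trace (F5 i) = 0"
proof -
  have "\<forall>i. trace (F5 i) = 0"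
    by (simp add: forall_5 F5_explicit trace_def sum_4)
  then show ?thesis by blast
qed

lemma F5_volume: "F5 1 ** F5 2 ** F5 3 ** F5 4 ** F5 0 = mat (- \<i>)"
proof -
  have "F5 1 ** F5 2 = vector [vector [-\<i>, 0, 0, 0], vector [0, \<i>, 0, 0], vector [0, 0, -\<i>, 0], vector [0, 0, 0, \<i>]]"
    and "F5 3 ** F5 4 = vector [vector [0, 0, -1, 0], vector [0, 0, 0, 1], vector [1, 0, 0, 0], vector [0, -1, 0, 0]]"
    by (simp_all add: F5_explicit vec_eq_iff forall_4 matrix_matrix_mult_def sum_4)
  moreover have "F5 1 ** F5 2 ** F5 3 ** F5 4 ** F5 0 = (F5 1 ** F5 2) ** (F5 3 ** F5 4) ** F5 0"
    by (simp add: matrix_mul_assoc)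
  ultimately show ?thesis
    by (simp add: F5_explicit(1)) (simp add: vec_eq_iff forall_4 matrix_matrix_mult_def sum_4 mat_def)
qed

text \<open>The value 4 is the trace of I_4; the divisions by 4 in the coordinates of 1-vectors
  normalize it.\<close>

lemma inner_F5: "F5 i \<bullet> F5 j = (if i = j then 4 else 0)"
proof -
  have "\<forall>i j. F5 i \<bullet> F5 j = (if i = j then 4 else 0)"
    by (simp add: forall_5 F5_explicit inner_vec_def sum_4)
  then show ?thesis by blast
qed

interpretation F5: clifford_matrices F5 "\<lambda>_. - 1" "[1, 2, 3, 4, 0]"
proof
  show "set [1, 2, 3, 4, 0] = (UNIV :: 5 set)" by (auto simp: UNIV_5)
  have "fword_prod F5 (FWord [1, 2, 3, 4, 0]) = mat (- \<i>)"
    using F5_volume by (simp add: matrix_mul_assoc)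
  \<comment> \<open>The trace itself is -4i; only its real part enters the real inner
    product.\<close>
  then show "Re (trace (fword_prod F5 (FWord [1, 2, 3, 4, 0]))) = 0"
    by (simp add: trace_def mat_def)
  show "F5 i ** F5 j = - (F5 j ** F5 i)" if "i \<noteq> j" for i j
    by (rule F5_anticommute[OF that])
qed (simp_all add: F5_square conj_transpose_F5)

lemma one_vector_basis_F5: "one_vector_basis 0 5 F5"
  by (rule F5.one_vector_basis) simp_all

lemma surj_free_eval_F5: "surj (free_eval F5)"
  by (rule F5.surj_free_eval) simp

lemma inj_F5: "inj F5"
  using inner_F5 by (metis injI zero_neq_numeral)

lemma independent_F5: "independent (range F5)"
proof (rule pairwise_orthogonal_independent)
  show "pairwise orthogonal (range F5)"
    by (auto simp: pairwise_def orthogonal_def inner_F5)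
  show "0 \<notin> range F5" using inner_F5 by (metis imageE inner_zero_left zero_neq_numeral)
qed

text \<open>The first two conditions say that Clifford conjugation negates v and that reversion
  fixes v, which leaves the grades 1 and 5. Grade 5 consists of the real multiples of i I_4, and the
  trace condition removes it.\<close>

lemma V5_characterization:
  "v \<in> V5 \<longleftrightarrow> conj_transpose v = - v \<and> transpose v ** Jhat4 = Jhat4 ** v \<and> trace v = 0"
    (is "_ \<longleftrightarrow> ?P v")
  and V5_expand: "v \<in> V5 \<Longrightarrow> v = (\<Sum>i\<in>UNIV. (v \<bullet> F5 i / 4) *\<^sub>R F5 i)"
proof -
  have P: "?P v" if "v \<in> V5" for v
    using that unfolding V5_def
  proof (induction rule: span_induct)
    show "subspace {v. ?P v}"
      unfolding subspace_def
      by (auto simp: conj_transpose_linear_simps transpose_linear_simps matrix_mult_distribs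
          matrix_mult_scale trace_add linear_0[OF linear_conj_transpose] linear_0[OF linear_transpose])
        (simp_all add: trace_def flip: scaleR_sum_right)
    show "?P v" if "v \<in> range F5" for v
      using that by (auto simp: conj_transpose_F5 transpose_F5_Jhat4 trace_F5)
  qed
  have eq: "v = (\<Sum>i\<in>UNIV. (v \<bullet> F5 i / 4) *\<^sub>R F5 i)" if v: "?P v" for v
  proof -
    \<comment> \<open>One real and two complex parameters, hence five real dimensions, survive the
      conditions; the expansion is then compared entrywise.\<close>
    define a b c where "a = Im (v$1$1)" and "b = v$1$3" and "c = v$1$4"
    from v have 1: "cnj (v$j$i) = - (v$i$j)" for i j
      by (simp add: conj_transpose_def vec_eq_iff)
    from v have 2: "(transpose v ** Jhat4)$i$j = (Jhat4 ** v)$i$j" for i j by simp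
    note 2 = 2[unfolded Jhat4_explicit matrix_matrix_mult_def transpose_def sum_4]
    have sym: "v$2$1 = 0" "v$1$2 = 0" "v$4$3 = 0" "v$3$4 = 0" "v$2$2 = v$1$1" "v$4$4 = v$3$3"
      "v$4$1 = v$2$3" "v$2$4 = - v$3$1" "v$4$2 = - v$1$3" "v$3$2 = v$1$4"
      using 2[of 1 1] 2[of 1 2] 2[of 1 3] 2[of 1 4] 2[of 2 2] 2[of 2 3] 2[of 2 4] 2[of 3 3] 2[of 3 4] 2[of 4 4]
      by simp_all
    have "v$3$3 = - (v$1$1)"
    proof -
      have "2 * (v$1$1 + v$3$3) = 0"
        using v sym by (simp add: trace_def sum_4 algebra_simps)
      then show ?thesis by (simp add: add_eq_0_iff)
    qed
    moreover have "v$1$1 = \<i> * a"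
      using 1[of 1 1] by (simp add: a_def complex_eq_iff)
    moreover have "v$2$3 = - cnj c" "v$3$1 = - cnj b"
      using 1[of 4 1] 1[of 3 1] 1[of 1 4] 1[of 1 3] sym by (simp_all add: b_def c_def)
    ultimately have "v = vector [vector [\<i> * a, 0, b, c], vector [0, \<i> * a, - cnj c, cnj b],
        vector [- cnj b, c, - \<i> * a, 0], vector [- cnj c, - b, 0, - \<i> * a]]"
      using sym by (simp add: vec_eq_iff forall_4 b_def c_def)
    then show ?thesis
      by (simp add: sum_5 F5_explicit inner_vec_def sum_4 vec_eq_iff forall_4 complex_eq_iff)
  qed
  have "v \<in> V5" if "?P v" for v
    by (subst eq[OF that], unfold V5_def) (intro span_sum span_scale span_base rangeI)
  with P show "v \<in> V5 \<longleftrightarrow> ?P v" by blast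
  show "v = (\<Sum>i\<in>UNIV. (v \<bullet> F5 i / 4) *\<^sub>R F5 i)" if "v \<in> V5"
    using P[OF that] by (rule eq)
qed

lemma F5_in_V5 [simp]: "F5 i \<in> V5"
  by (auto simp: V5_def intro: span_base)

lemma subspace_V5: "subspace V5"
  by (simp add: V5_def)

section \<open>Reversion, Clifford conjugation and the spin group\<close>

lemma Jhat4_cancel: "Jhat4 ** (Jhat4 ** X) = - X" "X ** Jhat4 ** Jhat4 = - X"
  by (simp_all add: matrix_mul_assoc Jhat4_square matrix_mult_scale)
    (simp add: Jhat4_square matrix_mult_scale flip: matrix_mul_assoc)

text \<open>\<open>Jhat4\<close> is skew-symmetric and squares to -1, so its inverse is
  \<open>- Jhat4\<close> and the map is an involution, which gives bijectivity.\<close>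

lemma is_reversion_V5: "is_reversion V5 (\<lambda>X. matrix_inv Jhat4 ** transpose X ** Jhat4)"
proof -
  let ?r = "\<lambda>X. - (Jhat4 ** transpose X ** Jhat4)"
  have "linear ?r"
    by (auto intro!: linearI simp: transpose_linear_simps matrix_mult_distribs matrix_mult_scale)
  moreover have invol: "?r (?r X) = X" for X
  proof -
    have "?r (?r X) = Jhat4 ** (Jhat4 ** X) ** Jhat4 ** Jhat4"
      by (simp add: transpose_linear_simps matrix_transpose_mul transpose_Jhat4 matrix_mult_scale
          matrix_mul_assoc)
    also have "\<dots> = X" by (simp only: Jhat4_cancel) (simp add: matrix_mult_scale Jhat4_cancel)
    finally show ?thesis .
  qed
  moreover have "bij ?r" by (rule involuntory_imp_bij) (rule invol)
  moreover have "?r (X ** Y) = ?r Y ** ?r X" for X Y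
  proof -
    have "?r Y ** ?r X = Jhat4 ** transpose Y ** Jhat4 ** Jhat4 ** transpose X ** Jhat4"
      by (simp add: matrix_mult_scale matrix_mul_assoc)
    then show ?thesis
      by (simp add: Jhat4_cancel matrix_mult_scale matrix_transpose_mul matrix_mul_assoc)
  qed
  moreover have "?r (mat 1) = mat 1" by (simp add: Jhat4_square)
  moreover have "?r v = v" if "v \<in> V5" for v
  proof -
    have "transpose v ** Jhat4 = Jhat4 ** v" using that V5_characterization by blast
    then show ?thesis by (simp add: Jhat4_cancel flip: matrix_mul_assoc)
  qed
  ultimately show ?thesis
    by (simp add: is_reversion_def anti_automorphism_def matrix_inv_Jhat4 matrix_mult_scale)
qed

lemma is_clifford_conj_V5: "is_clifford_conj V5 conj_transpose"
proof -
  have "bij (conj_transpose :: 4 cmat \<Rightarrow> 4 cmat)"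
    by (rule involuntory_imp_bij) simp
  then show ?thesis
    using V5_characterization linear_conj_transpose
    by (auto simp: is_clifford_conj_def anti_automorphism_def conj_transpose_mult)
qed

lemma is_reversion_V5_unique: "is_reversion V5 \<phi> \<Longrightarrow> is_reversion V5 \<psi> \<Longrightarrow> \<phi> = \<psi>"
  by (rule anti_automorphism_unique[OF surj_free_eval_F5]) (simp_all add: is_reversion_def)

lemma is_clifford_conj_V5_unique: "is_clifford_conj V5 \<phi> \<Longrightarrow> is_clifford_conj V5 \<psi> \<Longrightarrow> \<phi> = \<psi>"
  by (rule anti_automorphism_unique[OF surj_free_eval_F5]) (simp_all add: is_clifford_conj_def)

lemma reversion_V5: "reversion V5 = (\<lambda>X. matrix_inv Jhat4 ** transpose X ** Jhat4)"
  unfolding reversion_def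
  by (intro the_equality is_reversion_V5 is_reversion_V5_unique)

lemma clifford_conj_V5: "clifford_conj V5 = conj_transpose"
  unfolding clifford_conj_def
  by (intro the_equality is_clifford_conj_V5 is_clifford_conj_V5_unique)

text \<open>\<open>transpose (conj_transpose X)\<close> is the entrywise conjugate. The condition
  says that X commutes with the antilinear map v \<mapsto> J conj(v) of square -1, a quaternionic
  structure on C^4.\<close>

lemma grade_aut_V5_fixed_iff:
  "grade_aut V5 X = X \<longleftrightarrow> transpose (conj_transpose X) ** Jhat4 = Jhat4 ** X"
proof -
  let ?C = "transpose (conj_transpose X)"
  have "grade_aut V5 X = - (Jhat4 ** (?C ** Jhat4))"
    by (simp add: grade_aut_def reversion_V5 clifford_conj_V5 matrix_inv_Jhat4 matrix_mult_scale
        matrix_mul_assoc)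
  moreover have "- (Jhat4 ** (?C ** Jhat4)) = X \<longleftrightarrow> ?C ** Jhat4 = Jhat4 ** X"
    using Jhat4_cancel(1)[of "?C ** Jhat4"] Jhat4_cancel(1)[of X]
    by (metis add.inverse_inverse matrix_mult_scale(2))
  ultimately show ?thesis by simp
qed

lemma Sp4_hat_unitary:
  assumes "G \<in> Sp4_hat"
  shows "conj_transpose G ** G = mat 1" "G ** conj_transpose G = mat 1"
  using assms matrix_left_right_inverse by (auto simp: Sp4_hat_def)

text \<open>For unitary X the inverse of the transpose is the entrywise conjugate, so X^T J X = J
  turns into the condition for being fixed by the grade automorphism.\<close>

lemma Sp4_hat_iff:
  "X \<in> Sp4_hat \<longleftrightarrow> X ** conj_transpose X = mat 1
      \<and> transpose (conj_transpose X) ** Jhat4 = Jhat4 ** X" (is "_ \<longleftrightarrow> ?u \<and> ?J")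
proof
  let ?C = "transpose (conj_transpose X)"
  {
    assume X: "X \<in> Sp4_hat"
    have u: ?u by (rule Sp4_hat_unitary[OF X])
    have "?C ** transpose X = mat 1"
      using u by (simp flip: matrix_transpose_mul)
    then have "Jhat4 ** X = ?C ** (transpose X ** Jhat4 ** X)"
      by (simp add: matrix_mul_assoc)
    then show "?u \<and> ?J" using X u by (simp add: Sp4_hat_def)
  next
    assume X: "?u \<and> ?J"
    then have u: "conj_transpose X ** X = mat 1" using matrix_left_right_inverse by blast
    have "transpose X ** ?C = mat 1"
      using u by (simp flip: matrix_transpose_mul)
    then have "transpose X ** (?C ** Jhat4) = Jhat4"
      by (simp add: matrix_mul_assoc)
    then show "X \<in> Sp4_hat" using X u by (simp add: Sp4_hat_def matrix_mul_assoc)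
  }
qed

lemma Sp4_hat_transpose_Jhat4:
  assumes G: "G \<in> Sp4_hat"
  shows "transpose G ** Jhat4 = Jhat4 ** conj_transpose G"
proof -
  have "transpose G ** Jhat4 = transpose G ** Jhat4 ** G ** conj_transpose G"
    using Sp4_hat_unitary(2)[OF G] by (simp flip: matrix_mul_assoc)
  then show ?thesis using G by (simp add: Sp4_hat_def)
qed

lemma Sp4_hat_conj_V5:
  assumes G: "G \<in> Sp4_hat" and v: "v \<in> V5"
  shows "G ** v ** conj_transpose G \<in> V5"
proof -
  note u = Sp4_hat_unitary[OF G]
  have v': "conj_transpose v = - v" "transpose v ** Jhat4 = Jhat4 ** v" "trace v = 0"
    using v V5_characterization by blast+
  have GJ: "transpose G ** Jhat4 = Jhat4 ** conj_transpose G"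
    by (rule Sp4_hat_transpose_Jhat4[OF G])
  have CJ: "transpose (conj_transpose G) ** Jhat4 = Jhat4 ** G"
    using G by (simp add: Sp4_hat_iff)
  let ?w = "G ** v ** conj_transpose G"
  have "conj_transpose ?w = - ?w"
    by (simp add: conj_transpose_mult v' matrix_mult_scale matrix_mul_assoc)
  moreover have "transpose ?w ** Jhat4 = Jhat4 ** ?w"
  proof -
    have "transpose ?w ** Jhat4 = transpose (conj_transpose G) ** (transpose v ** (transpose G ** Jhat4))"
      by (simp add: matrix_transpose_mul matrix_mul_assoc)
    also have "\<dots> = transpose (conj_transpose G) ** ((transpose v ** Jhat4) ** conj_transpose G)"
      by (simp add: GJ matrix_mul_assoc)
    also have "\<dots> = (transpose (conj_transpose G) ** Jhat4) ** (v ** conj_transpose G)"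
      by (simp add: v' matrix_mul_assoc)
    also have "\<dots> = Jhat4 ** ?w" by (simp add: CJ matrix_mul_assoc)
    finally show ?thesis .
  qed
  moreover have "trace ?w = 0"
  proof -
    have "trace ?w = trace (conj_transpose G ** (G ** v))" by (rule trace_mul_sym)
    then show ?thesis by (simp add: u matrix_mul_assoc v')
  qed
  ultimately show ?thesis using V5_characterization by blast
qed

lemma Spin5_eq_Sp4_hat: "Spin5 = Sp4_hat"
  using Sp4_hat_conj_V5
  by (auto simp: Spin5_def Spin_def clifford_conj_V5 grade_aut_V5_fixed_iff Sp4_hat_iff)

section \<open>Coordinates on the space of 1-vectors\<close>

definition vec5 :: "real^5 \<Rightarrow> 4 cmat" where
  "vec5 x = (\<Sum>i\<in>UNIV. x $ i *\<^sub>R F5 i)"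

lemma linear_vec5: "linear vec5"
  by (auto intro!: linearI simp: vec5_def scaleR_add_left sum.distrib scaleR_sum_right)

lemmas vec5_linear_simps = linear_add[OF linear_vec5] linear_diff[OF linear_vec5]
  linear_neg[OF linear_vec5] linear_cmul[OF linear_vec5]

lemma vec5_in_V5: "vec5 x \<in> V5"
  unfolding vec5_def by (intro subspace_sum subspace_scale subspace_V5 F5_in_V5)

lemma vec5_axis [simp]: "vec5 (axis i 1) = F5 i"
  by (simp add: vec5_def axis_def if_distrib if_distribR cong: if_cong)

lemma vec5_inner_F5: "vec5 x \<bullet> F5 i = 4 * x $ i"
  by (simp add: vec5_def inner_sum_left inner_F5 if_distrib if_distribR cong: if_cong)

lemma inner_vec5: "vec5 x \<bullet> vec5 y = 4 * (x \<bullet> y)"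
proof -
  have "vec5 x \<bullet> vec5 y = (\<Sum>i\<in>UNIV. y $ i * (vec5 x \<bullet> F5 i))"
    by (subst (2) vec5_def) (simp add: inner_sum_right)
  also have "\<dots> = (\<Sum>i\<in>UNIV. y $ i * (4 * x $ i))" by (simp only: vec5_inner_F5)
  finally show ?thesis by (simp add: inner_vec_def[of x y] sum_distrib_left mult_ac)
qed

lemma vec5_surj: "v \<in> V5 \<Longrightarrow> v = vec5 (\<chi> i. v \<bullet> F5 i / 4)"
  using V5_expand by (simp add: vec5_def)

text \<open>The Clifford relations in polarized form; both the reflection formula and the brackets
  with products of two generators come from it.\<close>

lemma vec5_anticommutator:
  "vec5 x ** vec5 y + vec5 y ** vec5 x = (- 2 * (x \<bullet> y)) *\<^sub>R mat 1"
proof -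
  have F: "F5 i ** F5 j + F5 j ** F5 i = (if i = j then - 2 else 0) *\<^sub>R mat 1" for i j
  proof -
    have "(- 2 :: real) *\<^sub>R A = - A - A" for A :: "4 cmat" using scaleR_2[of A] by simp
    then show ?thesis using F5_anticommute[of i j] F5_square[of i] by auto
  qed
  have E: "vec5 x ** vec5 y = (\<Sum>i\<in>UNIV. \<Sum>j\<in>UNIV. (x $ i * y $ j) *\<^sub>R (F5 i ** F5 j))" for x y
    by (simp add: vec5_def matrix_mult_sum_left matrix_mult_sum_right matrix_mult_scale scaleR_sum_right)
      (subst sum.swap, simp add: mult.commute)
  have "vec5 y ** vec5 x = (\<Sum>i\<in>UNIV. \<Sum>j\<in>UNIV. (y $ j * x $ i) *\<^sub>R (F5 j ** F5 i))"
    unfolding E by (rule sum.swap)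
  then have "vec5 x ** vec5 y + vec5 y ** vec5 x
      = (\<Sum>i\<in>UNIV. \<Sum>j\<in>UNIV. (x $ i * y $ j) *\<^sub>R (F5 i ** F5 j + F5 j ** F5 i))"
    by (simp add: E scaleR_add_right sum.distrib mult.commute)
  also have "\<dots> = (\<Sum>i\<in>UNIV. \<Sum>j\<in>UNIV. if j = i then (- 2 * (x $ i * y $ i)) *\<^sub>R mat 1 else 0)"
    unfolding F by (intro sum.cong) auto
  also have "\<dots> = (- 2 * (x \<bullet> y)) *\<^sub>R mat 1"
    by (simp add: inner_vec_def sum_distrib_left sum_negf scaleR_sum_left)
  finally show ?thesis .
qed

lemma vec5_square: "vec5 x ** vec5 x = - (x \<bullet> x) *\<^sub>R mat 1"
proof -
  have "2 *\<^sub>R (vec5 x ** vec5 x) = 2 *\<^sub>R (- (x \<bullet> x) *\<^sub>R mat 1)"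
    using vec5_anticommutator[of x x] by (simp flip: scaleR_2)
  then show ?thesis unfolding scaleR_cancel_left by simp
qed

lemma representation_F5:
  assumes "v \<in> V5"
  shows "representation (range F5) v (F5 i) = v \<bullet> F5 i / 4"
proof -
  have "v = (\<Sum>b\<in>range F5. representation (range F5) v b *\<^sub>R b)"
    using sum_representation_eq[OF independent_F5, of v "range F5"] assms
    by (simp add: V5_def)
  also have "\<dots> = (\<Sum>j\<in>UNIV. representation (range F5) v (F5 j) *\<^sub>R F5 j)"
    by (simp add: sum.reindex[OF inj_F5])
  finally have "v \<bullet> F5 i = (\<Sum>j\<in>UNIV. representation (range F5) v (F5 j) *\<^sub>R F5 j) \<bullet> F5 i" by simp
  then show ?thesis
    by (simp add: inner_sum_left inner_F5 if_distrib if_distribR cong: if_cong)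
qed

lemma matrix_wrt_F5_nth:
  "(\<And>j. T (F5 j) \<in> V5) \<Longrightarrow> matrix_wrt F5 T $ i $ j = T (F5 j) \<bullet> F5 i / 4"
  by (simp add: matrix_wrt_def representation_F5)

lemma matrix_wrt_F5_apply:
  assumes "linear T" "\<And>j. T (F5 j) \<in> V5"
  shows "T (vec5 x) = vec5 (matrix_wrt F5 T *v x)"
proof -
  have "T (F5 j) = (\<Sum>i\<in>UNIV. matrix_wrt F5 T $ i $ j *\<^sub>R F5 i)" for j
    using vec5_surj[OF assms(2)[of j]] by (simp add: vec5_def matrix_wrt_F5_nth[of T] assms(2))
  then have "T (vec5 x) = (\<Sum>j\<in>UNIV. \<Sum>i\<in>UNIV. (matrix_wrt F5 T $ i $ j * x $ j) *\<^sub>R F5 i)"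
    by (simp add: vec5_def linear_sum[OF assms(1)] linear_cmul[OF assms(1)] scaleR_sum_right mult.commute)
  then show ?thesis
    by (subst (asm) sum.swap) (simp add: vec5_def matrix_vector_mult_def scaleR_sum_left)
qed

text \<open>The hypothesis itself places each \<open>T (F5 j)\<close> in \<open>V5\<close>, where
  coordinates are meaningful.\<close>

lemma matrix_wrt_F5_eqI:
  assumes "\<And>x. T (vec5 x) = vec5 (M *v x)"
  shows "matrix_wrt F5 T = M"
proof -
  have T: "T (F5 j) = vec5 (column j M)" for j
    using assms[of "axis j 1"] by (simp add: matrix_vector_mul_component matrix_vector_mult_basis)
  have "matrix_wrt F5 T $ i $ j = M $ i $ j" for i j
    by (subst matrix_wrt_F5_nth) (simp_all add: T vec5_in_V5 vec5_inner_F5 column_def)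
  then show ?thesis by (simp add: vec_eq_iff)
qed

section \<open>The covering map\<close>

lemma Sp4_hat_one: "mat 1 \<in> Sp4_hat"
  by (simp add: Sp4_hat_def)

lemma Sp4_hat_mult:
  assumes "X \<in> Sp4_hat" "Y \<in> Sp4_hat"
  shows "X ** Y \<in> Sp4_hat"
proof -
  have "conj_transpose (X ** Y) ** (X ** Y) = conj_transpose Y ** (conj_transpose X ** X) ** Y"
    by (simp add: conj_transpose_mult matrix_mul_assoc)
  moreover have "transpose (X ** Y) ** Jhat4 ** (X ** Y)
      = transpose Y ** (transpose X ** Jhat4 ** X) ** Y"
    by (simp add: matrix_transpose_mul matrix_mul_assoc)
  ultimately show ?thesis using assms by (simp add: Sp4_hat_def)
qed

lemma Sp4_hat_adjoint: "X \<in> Sp4_hat \<Longrightarrow> conj_transpose X \<in> Sp4_hat"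
  using Sp4_hat_transpose_Jhat4[of X] Sp4_hat_unitary[of X] by (simp add: Sp4_hat_iff)

lemma Sp4_hat_uminus: "X \<in> Sp4_hat \<Longrightarrow> - X \<in> Sp4_hat"
  by (simp add: Sp4_hat_def conj_transpose_linear_simps transpose_linear_simps matrix_mult_scale)

lemma Phi5_eq_matrix_wrt: "Phi5 G = matrix_wrt F5 (\<lambda>v. G ** v ** conj_transpose G)"
  unfolding Phi5_def spin_cover_def using clifford_conj_V5 by (simp add: V5_def)

lemma Phi5_nth: "G \<in> Sp4_hat \<Longrightarrow> Phi5 G $ i $ j = (G ** F5 j ** conj_transpose G) \<bullet> F5 i / 4"
  unfolding Phi5_eq_matrix_wrt by (rule matrix_wrt_F5_nth) (simp add: Sp4_hat_conj_V5)

lemma Phi5_apply: "G \<in> Sp4_hat \<Longrightarrow> vec5 (Phi5 G *v x) = G ** vec5 x ** conj_transpose G"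
  unfolding Phi5_eq_matrix_wrt
  by (rule matrix_wrt_F5_apply[symmetric])
    (auto intro!: linearI simp: Sp4_hat_conj_V5 matrix_mult_distribs matrix_mult_scale)

lemma Phi5_eqI: "(\<And>x. G ** vec5 x ** conj_transpose G = vec5 (M *v x)) \<Longrightarrow> Phi5 G = M"
  unfolding Phi5_eq_matrix_wrt by (rule matrix_wrt_F5_eqI)

lemma Phi5_mult:
  assumes "X \<in> Sp4_hat" "Y \<in> Sp4_hat"
  shows "Phi5 (X ** Y) = Phi5 X ** Phi5 Y"
proof (rule Phi5_eqI)
  fix x
  have "vec5 ((Phi5 X ** Phi5 Y) *v x) = X ** (Y ** vec5 x ** conj_transpose Y) ** conj_transpose X"
    using assms by (simp add: Phi5_apply flip: matrix_vector_mul_assoc)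
  then show "X ** Y ** vec5 x ** conj_transpose (X ** Y) = vec5 ((Phi5 X ** Phi5 Y) *v x)"
    by (simp add: conj_transpose_mult matrix_mul_assoc)
qed

lemma Phi5_one: "Phi5 (mat 1) = mat 1"
  by (rule Phi5_eqI) simp

lemma Phi5_uminus: "Phi5 (- X) = Phi5 X"
  by (simp add: Phi5_eq_matrix_wrt conj_transpose_linear_simps matrix_mult_scale)

lemma orthogonal_Phi5:
  assumes "G \<in> Sp4_hat"
  shows "orthogonal_matrix (Phi5 G)"
proof -
  have "(Phi5 G *v x) \<bullet> (Phi5 G *v y) = x \<bullet> y" for x y
    using inner_unitary_conj[OF Sp4_hat_unitary(1)[OF assms], of "vec5 x" "vec5 y"]
    by (simp add: inner_vec5 flip: Phi5_apply[OF assms])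
  then have "orthogonal_transformation (\<lambda>x. Phi5 G *v x)"
    by (simp add: orthogonal_transformation_def)
  then show ?thesis by (simp add: orthogonal_transformation_matrix)
qed

section \<open>Reflections and surjectivity onto the rotations\<close>

definition reflection_matrix :: "real^'n::finite \<Rightarrow> real^'n^'n" where
  "reflection_matrix u = (\<chi> i j. (if i = j then 1 else 0) - 2 * u $ i * u $ j)"

lemma reflection_matrix_apply:
  "reflection_matrix u *v y = y - (2 * (u \<bullet> y)) *\<^sub>R u"
proof -
  have "(\<Sum>j\<in>UNIV. ((if i = j then 1 else 0) - 2 * u $ i * u $ j) * y $ j)
      = (\<Sum>j\<in>UNIV. if i = j then y $ j else 0) - 2 * u $ i * (\<Sum>j\<in>UNIV. u $ j * y $ j)" for i
    unfolding sum_distrib_left sum_subtractf[symmetric]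
    by (intro sum.cong) (auto simp: algebra_simps)
  then show ?thesis
    by (simp add: reflection_matrix_def matrix_vector_mult_def vec_eq_iff inner_vec_def mult_ac)
qed

text \<open>An orthogonal change of basis carries a coordinate axis to the unit vector u, which
  leaves a diagonal matrix with a single entry -1.\<close>

lemma det_reflection_matrix:
  fixes u :: "real^'n::finite"
  assumes "norm u = 1"
  shows "det (reflection_matrix u) = - 1"
proof -
  define k :: 'n where "k = undefined"
  obtain A where A: "orthogonal_matrix A" "A *v axis k 1 = u"
    using orthogonal_matrix_exists_basis[OF assms] by blast
  have "reflection_matrix u = A ** reflection_matrix (axis k 1) ** transpose A"
  proof -
    have "(A ** reflection_matrix (axis k 1) ** transpose A) *v y = reflection_matrix u *v y" for y
    proof -
      have "axis k 1 \<bullet> (transpose A *v y) = u \<bullet> y"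
        by (metis A(2) dot_lmul_matrix vector_transpose_matrix)
      moreover have "A *v (transpose A *v y) = y"
        using A(1) by (simp add: orthogonal_matrix_def matrix_vector_mul_assoc
            del: transpose_matrix_vector)
      ultimately show ?thesis
        by (simp add: reflection_matrix_apply A(2) matrix_vector_mult_diff_distrib
            matrix_vector_mult_scaleR flip: matrix_vector_mul_assoc del: transpose_matrix_vector)
    qed
    then show ?thesis by (simp add: matrix_eq)
  qed
  then have "det (reflection_matrix u) = det (A ** transpose A) * det (reflection_matrix (axis k 1))"
    by (simp add: det_mul)
  also have "\<dots> = det (reflection_matrix (axis k 1 :: real^'n))"
    using A(1) by (simp add: orthogonal_matrix_def)
  also have "\<dots> = (\<Prod>i\<in>UNIV. reflection_matrix (axis k 1) $ i $ i)"
    by (rule det_diagonal) (auto simp: reflection_matrix_def axis_def)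
  also have "\<dots> = (\<Prod>i\<in>UNIV. if i = k then - 1 else 1)"
    by (intro prod.cong) (auto simp: reflection_matrix_def axis_def)
  finally show ?thesis by simp
qed

text \<open>A single unit 1-vector acts by a reflection, so an even product of them lies in the group.\<close>

lemma vec5_pair_in_Sp4_hat:
  assumes "norm u = 1" "norm v = 1"
  shows "vec5 v ** vec5 u \<in> Sp4_hat"
proof -
  have sq: "vec5 u ** vec5 u = - mat 1" "vec5 v ** vec5 v = - mat 1"
    using assms by (simp_all add: vec5_square norm_eq_1)
  have c: "conj_transpose (vec5 x) = - vec5 x" "transpose (vec5 x) ** Jhat4 = Jhat4 ** vec5 x" for x
    using V5_characterization vec5_in_V5 by blast+
  have "conj_transpose (vec5 v ** vec5 u) ** (vec5 v ** vec5 u) = vec5 u ** (vec5 v ** vec5 v) ** vec5 u"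
    by (simp add: conj_transpose_mult c matrix_mult_scale matrix_mul_assoc)
  also have "\<dots> = mat 1" by (simp add: sq matrix_mult_scale)
  finally have 1: "conj_transpose (vec5 v ** vec5 u) ** (vec5 v ** vec5 u) = mat 1" .
  have "transpose (vec5 v ** vec5 u) ** Jhat4 ** (vec5 v ** vec5 u)
      = transpose (vec5 u) ** (transpose (vec5 v) ** Jhat4) ** vec5 v ** vec5 u"
    by (simp add: matrix_transpose_mul matrix_mul_assoc)
  also have "\<dots> = (transpose (vec5 u) ** Jhat4) ** (vec5 v ** vec5 v) ** vec5 u"
    by (simp only: c matrix_mul_assoc)
  also have "\<dots> = - (Jhat4 ** (vec5 u ** vec5 u))"
    by (simp add: sq c matrix_mult_scale flip: matrix_mul_assoc)
  also have "\<dots> = Jhat4" by (simp add: sq matrix_mult_scale)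
  finally show ?thesis using 1 by (simp add: Sp4_hat_def)
qed

text \<open>For a unit vector u, moving u past y gives u y u = - 2 (u \<bullet> y) u - y u^2, and
  u^2 = -1 makes this the reflection itself. The adjoint of v u is u v, its two minus signs
  cancelling.\<close>

lemma Phi5_vec5_pair:
  assumes "norm u = 1" "norm v = 1"
  shows "Phi5 (vec5 v ** vec5 u) = reflection_matrix v ** reflection_matrix u"
proof (rule Phi5_eqI)
  fix x
  have c: "conj_transpose (vec5 x) = - vec5 x" for x
    using V5_characterization vec5_in_V5 by blast
  have refl: "vec5 u ** vec5 y ** vec5 u = vec5 (reflection_matrix u *v y)" if "norm u = 1" for u y
  proof -
    have "vec5 u ** vec5 y = (- 2 * (u \<bullet> y)) *\<^sub>R mat 1 - vec5 y ** vec5 u"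
      using vec5_anticommutator[of u y] by (simp add: eq_diff_eq)
    then have "vec5 u ** vec5 y ** vec5 u = (- 2 * (u \<bullet> y)) *\<^sub>R vec5 u - vec5 y ** (vec5 u ** vec5 u)"
      by (simp add: matrix_mult_distribs matrix_mult_scale matrix_mul_assoc)
    then show ?thesis
      using that by (simp add: vec5_square norm_eq_1 matrix_mult_scale reflection_matrix_apply
          vec5_linear_simps)
  qed
  have "vec5 v ** vec5 u ** vec5 x ** conj_transpose (vec5 v ** vec5 u)
      = vec5 v ** (vec5 u ** vec5 x ** vec5 u) ** vec5 v"
    by (simp add: conj_transpose_mult c matrix_mult_scale matrix_mul_assoc)
  then show "vec5 v ** vec5 u ** vec5 x ** conj_transpose (vec5 v ** vec5 u)
      = vec5 ((reflection_matrix v ** reflection_matrix u) *v x)"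
    by (simp add: refl assms flip: matrix_vector_mul_assoc)
qed

text \<open>Preserving inner products makes column k orthogonal to the fixed axes, so R is diagonal
  and its determinant is the entry at k.\<close>

lemma rotation_fixing_all_but_one_axis:
  fixes R :: "real^'n::finite^'n"
  assumes R: "rotation_matrix R" and fixed: "\<And>i. i \<noteq> k \<Longrightarrow> R *v axis i 1 = axis i 1"
  shows "R = mat 1"
proof -
  have orth: "(R *v x) \<bullet> (R *v y) = x \<bullet> y" for x y
    using R orthogonal_transformation_matrix[of "(*v) R"]
    by (simp add: rotation_matrix_def orthogonal_transformation_def)
  have col: "R $ i $ j = (if i = j then 1 else 0)" if "j \<noteq> k" for i j
  proof -
    have "column j R = axis j 1"
      using fixed[OF that] by (simp add: matrix_vector_mult_basis)
    then have "column j R $ i = axis j 1 $ i" by simp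
    then show ?thesis by (simp add: column_def axis_def)
  qed
  have row: "R $ i $ k = 0" if "i \<noteq> k" for i
  proof -
    have "R $ i $ k = axis i 1 \<bullet> (R *v axis k 1)"
      by (simp add: inner_axis' matrix_vector_mult_basis column_def)
    also have "\<dots> = axis i 1 \<bullet> (axis k 1 :: real^'n)"
      using orth[of "axis i 1" "axis k 1"] fixed[OF that] by simp
    also have "\<dots> = 0" using that by (simp add: inner_axis_axis)
    finally show ?thesis .
  qed
  have "det R = (\<Prod>i\<in>UNIV. R $ i $ i)"
    by (rule det_diagonal) (metis col row)
  also have "\<dots> = (\<Prod>i\<in>UNIV. if i = k then R $ k $ k else 1)"
    by (intro prod.cong) (auto simp: col)
  also have "\<dots> = R $ k $ k" by simp
  finally have "R $ k $ k = 1" using R by (simp add: rotation_matrix_def)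
  then show ?thesis
    using col row by (simp add: vec_eq_iff mat_def) metis
qed

text \<open>Induction on the number of axes that need not be fixed: if \<open>a = R e\<^sub>k\<close> differs from \<open>e\<^sub>k\<close>, the
  reflection in \<open>a - e\<^sub>k\<close> moves it to \<open>e\<^sub>k\<close>, and a further free axis \<open>e\<^sub>m\<close> provides the second
  reflection that restores the determinant.\<close>

lemma Phi5_onto_rotation_fixing:
  assumes "rotation_matrix R" "\<And>i. i \<in> I \<Longrightarrow> R *v axis i 1 = axis i 1"
  shows "\<exists>X\<in>Sp4_hat. Phi5 X = R"
  using assms
proof (induction "card (- I)" arbitrary: I R rule: less_induct)
  case less
  note R = less.prems
  show ?case
  proof (cases "\<exists>k m. k \<notin> I \<and> m \<notin> I \<and> k \<noteq> m")
    case False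
    then obtain k where "\<And>i. i \<noteq> k \<Longrightarrow> i \<in> I" by metis
    then have "R = mat 1"
      using rotation_fixing_all_but_one_axis R by blast
    then show ?thesis using Sp4_hat_one Phi5_one by blast
  next
    case True
    then obtain k m where km: "k \<notin> I" "m \<notin> I" "k \<noteq> m" by blast
    have small: "card (- insert k I) < card (- I)"
      by (rule psubset_card_mono) (use km in auto)
    have orth: "(R *v x) \<bullet> (R *v y) = x \<bullet> y" for x y
      using R(1) orthogonal_transformation_matrix[of "(*v) R"]
      by (simp add: rotation_matrix_def orthogonal_transformation_def)
    define a where "a = R *v axis k 1"
    have a1: "a \<bullet> a = 1" unfolding a_def orth by (simp add: inner_axis_axis)
    have aI: "a \<bullet> axis i 1 = 0" if "i \<in> I" for i
      using orth[of "axis k 1" "axis i 1"] R(2)[OF that] that km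
      by (auto simp: a_def inner_axis_axis)
    show ?thesis
    proof (cases "a = axis k 1")
      case True
      then show ?thesis
        using less.hyps[OF small R(1)] R(2) by (auto simp: a_def)
    next
      case False
      define d where "d = a - axis k 1"
      define u where "u = d /\<^sub>R norm d"
      have d0: "norm d \<noteq> 0" using False by (simp add: d_def)
      then have u1: "norm u = 1" by (simp add: u_def)
      have m1: "norm (axis m 1 :: real^5) = 1" by (simp add: norm_axis_1)
      have ua: "reflection_matrix u *v a = axis k 1"
      proof -
        \<comment> \<open>As a and the axis are unit vectors, both sides equal 2 - 2 (a \<bullet>
          axis k 1); hence the reflection subtracts exactly d from a.\<close>
        have "2 * (d \<bullet> a) = d \<bullet> d"
          using a1 by (simp add: d_def inner_diff_left inner_diff_right inner_commute inner_axis_axis)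
        moreover have "(2 * (u \<bullet> a)) *\<^sub>R u = (2 * (d \<bullet> a) / (norm d)\<^sup>2) *\<^sub>R d"
          by (simp add: u_def power2_eq_square divide_inverse mult_ac)
        ultimately have "(2 * (u \<bullet> a)) *\<^sub>R u = d"
          using d0 by (simp add: power2_norm_eq_inner)
        then show ?thesis by (simp add: reflection_matrix_apply d_def)
      qed
      have uI: "reflection_matrix u *v axis i 1 = axis i 1" if "i \<in> I" for i
      proof -
        have "u \<bullet> axis i 1 = 0"
          using aI[OF that] that km(1) by (auto simp: u_def d_def inner_diff_left inner_axis_axis)
        then show ?thesis by (simp add: reflection_matrix_apply)
      qed
      have mI: "reflection_matrix (axis m 1) *v axis i 1 = axis i 1" if "i \<noteq> m" for i
        using that by (simp add: reflection_matrix_apply inner_axis_axis)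
      define X where "X = vec5 (axis m 1) ** vec5 u"
      have X: "X \<in> Sp4_hat" unfolding X_def by (rule vec5_pair_in_Sp4_hat[OF u1 m1])
      have PX: "Phi5 X = reflection_matrix (axis m 1) ** reflection_matrix u"
        unfolding X_def by (rule Phi5_vec5_pair[OF u1 m1])
      have "rotation_matrix (Phi5 X ** R)"
        using R(1) orthogonal_Phi5[OF X] det_reflection_matrix[OF u1] det_reflection_matrix[OF m1]
        by (auto simp: rotation_matrix_def det_mul orthogonal_matrix_mul PX)
      moreover have "(Phi5 X ** R) *v axis i 1 = axis i 1" if "i \<in> insert k I" for i
      proof -
        have "reflection_matrix u *v (R *v axis i 1) = axis i 1"
          using that ua uI R(2) by (auto simp: a_def)
        then show ?thesis
          using that km mI[of i] by (auto simp: PX simp flip: matrix_vector_mul_assoc)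
      qed
      ultimately obtain Y where Y: "Y \<in> Sp4_hat" "Phi5 Y = Phi5 X ** R"
        using less.hyps[OF small, of "Phi5 X ** R"] by blast
      \<comment> \<open>The adjoint inverts X, so multiplying by it takes the two reflections off
        again.\<close>
      have "Phi5 (conj_transpose X ** Y) = Phi5 (conj_transpose X ** X) ** R"
        using X Y Sp4_hat_adjoint[OF X] by (simp add: Phi5_mult matrix_mul_assoc)
      then have "Phi5 (conj_transpose X ** Y) = R"
        using Sp4_hat_unitary(1)[OF X] by (simp add: Phi5_one)
      then show ?thesis using Sp4_hat_mult[OF Sp4_hat_adjoint[OF X] Y(1)] by blast
    qed
  qed
qed

lemma Phi5_onto_SO: "R \<in> SO \<Longrightarrow> \<exists>X\<in>Sp4_hat. Phi5 X = R"
  by (rule Phi5_onto_rotation_fixing[of _ "{}"]) (simp_all add: SO_def)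

text \<open>A preimage \<open>Z\<close> of \<open>-1\<close> would anticommute with all five generators and hence with their product, which is
  the central element \<open>- \<i> I\<close>.\<close>

lemma Phi5_neq_minus_one:
  assumes "Z \<in> Sp4_hat"
  shows "Phi5 Z \<noteq> - mat 1"
proof
  assume P: "Phi5 Z = - mat 1"
  have anti: "Z ** F5 i = - (F5 i ** Z)" for i
  proof -
    have "Z ** F5 i ** conj_transpose Z = vec5 (- axis i 1)"
      using Phi5_apply[OF assms, of "axis i 1"] P
      by (metis diff_0 matrix_vector_mul_lid matrix_vector_mult_0 matrix_vector_mult_diff_rdistrib
          vec5_axis)
    then have "Z ** F5 i ** (conj_transpose Z ** Z) = - (F5 i ** Z)"
      by (simp add: matrix_mul_assoc vec5_linear_simps matrix_mult_scale)
    then show ?thesis using Sp4_hat_unitary[OF assms] by simp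
  qed
  then have "F5 i ** Z = - (Z ** F5 i)" "Y ** F5 i ** Z = - (Y ** Z ** F5 i)" for Y :: "4 cmat" and i
    by (simp_all add: matrix_mult_scale flip: matrix_mul_assoc)
  then have "F5 1 ** F5 2 ** F5 3 ** F5 4 ** F5 0 ** Z = - (Z ** (F5 1 ** F5 2 ** F5 3 ** F5 4 ** F5 0))"
    by (simp add: matrix_mul_assoc matrix_mult_scale)
  then have "mat (- \<i>) ** Z = - (mat (- \<i>) ** Z)"
    unfolding F5_volume by (simp add: mat_mult_commute)
  moreover have "(mat (- \<i>) ** Z) $ i $ j = - \<i> * Z $ i $ j" for i j
    by (simp add: matrix_matrix_mult_def mat_def if_distrib if_distribR cong: if_cong)
  ultimately have "Z = 0" by (simp add: vec_eq_iff)
  then have "(mat 1 :: 4 cmat) = 0" using Sp4_hat_unitary(1)[OF assms] by simp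
  then show False using mat_1_neq_0 by blast
qed

text \<open>If \<open>Phi5 G\<close> had determinant \<open>-1\<close>, then \<open>- Phi5 G\<close> would be in the image, hence so would \<open>-1\<close>.\<close>

lemma det_Phi5:
  assumes "G \<in> Sp4_hat"
  shows "det (Phi5 G) = 1"
proof (rule ccontr)
  assume "det (Phi5 G) \<noteq> 1"
  then have "det (Phi5 G) = - 1"
    using det_orthogonal_matrix[OF orthogonal_Phi5[OF assms]] by auto
  moreover have "det (- mat 1 :: real^5^5) = (\<Prod>i\<in>(UNIV :: 5 set). - 1)"
    by (subst det_diagonal) (simp_all add: mat_def)
  ultimately have "det (- Phi5 G) = 1"
    using det_mul[of "- mat 1" "Phi5 G"] by (simp add: matrix_mult_scale)
  moreover have "orthogonal_matrix (- Phi5 G)"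
    using orthogonal_Phi5[OF assms]
    by (simp add: orthogonal_matrix_def matrix_mult_scale transpose_linear_simps)
  ultimately have "- Phi5 G \<in> SO" by (simp add: SO_def rotation_matrix_def)
  then obtain Y where Y: "Y \<in> Sp4_hat" "Phi5 Y = - Phi5 G" using Phi5_onto_SO by blast
  note G' = Sp4_hat_adjoint[OF assms]
  have "Phi5 (Y ** conj_transpose G) = - Phi5 (G ** conj_transpose G)"
    using Y assms G' by (simp add: Phi5_mult matrix_mult_scale)
  then have "Phi5 (Y ** conj_transpose G) = - mat 1"
    using Sp4_hat_unitary(2)[OF assms] by (simp add: Phi5_one)
  then show False using Phi5_neq_minus_one Sp4_hat_mult[OF Y(1) G'] by blast
qed

lemma Phi5_image: "Phi5 ` Sp4_hat = SO"
  using Phi5_onto_SO orthogonal_Phi5 det_Phi5 by (fastforce simp: SO_def rotation_matrix_def)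

section \<open>Fibres, compactness and the covering property\<close>

lemma commutant_F5_Sp4_hat:
  assumes Z: "Z \<in> Sp4_hat" and comm: "\<And>i. Z ** F5 i = F5 i ** Z"
  shows "Z = mat 1 \<or> Z = - mat 1"
proof -
  obtain c where c: "Z = mat c"
    using commutes_with_generators[OF surj_free_eval_F5 comm] by (rule commuting_with_all_scalar)
  \<comment> \<open>The (1,2) entry of \<open>Jhat4\<close> is 1, so the quaternionic condition
    reads cnj c = c; for real c unitarity leaves only 1 and -1.\<close>
  have "(transpose (conj_transpose Z) ** Jhat4) $ 1 $ 2 = (Jhat4 ** Z) $ 1 $ 2"
    using Z Sp4_hat_iff by simp
  then have "cnj c = c"
    by (simp add: c Jhat4_explicit matrix_matrix_mult_def sum_4 transpose_def conj_transpose_def mat_def)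
  moreover have "(conj_transpose Z ** Z) $ 1 $ 1 = (mat 1 :: 4 cmat) $ 1 $ 1"
    using Sp4_hat_unitary(1)[OF Z] by simp
  then have "cnj c * c = 1"
    by (simp add: c matrix_matrix_mult_def sum_4 conj_transpose_def mat_def)
  ultimately have "c = 1 \<or> c = - 1" by (simp add: square_eq_1_iff)
  then show ?thesis by (auto simp: c mat_def vec_eq_iff)
qed

lemma Phi5_eq_iff:
  assumes "X \<in> Sp4_hat" "Y \<in> Sp4_hat"
  shows "Phi5 X = Phi5 Y \<longleftrightarrow> Y = X \<or> Y = - X"
proof
  assume eq: "Phi5 X = Phi5 Y"
  define Z where "Z = conj_transpose X ** Y"
  note X' = Sp4_hat_adjoint[OF assms(1)]
  have Z: "Z \<in> Sp4_hat" unfolding Z_def by (rule Sp4_hat_mult[OF X' assms(2)])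
  have "Phi5 Z = Phi5 (conj_transpose X ** X)"
    using X' assms eq by (simp add: Z_def Phi5_mult)
  then have "Phi5 Z = mat 1" using Sp4_hat_unitary[OF assms(1)] by (simp add: Phi5_one)
  then have "F5 i = Z ** F5 i ** conj_transpose Z" for i
    using Phi5_apply[OF Z, of "axis i 1"] by simp
  then have "F5 i ** Z = Z ** F5 i ** (conj_transpose Z ** Z)" for i
    by (metis matrix_mul_assoc)
  then have "Z = mat 1 \<or> Z = - mat 1"
    using Sp4_hat_unitary[OF Z] by (intro commutant_F5_Sp4_hat Z) simp
  moreover have "Y = X ** Z"
    using Sp4_hat_unitary[OF assms(1)] by (simp add: Z_def matrix_mul_assoc)
  ultimately show "Y = X \<or> Y = - X" by (auto simp: matrix_mult_scale)
qed (auto simp: Phi5_uminus)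

text \<open>Unitarity puts the group on the sphere of radius 2, the squared norm being the trace of
  I_4.\<close>

lemma compact_Sp4_hat: "compact Sp4_hat"
proof -
  have "norm X = 2" if "X \<in> Sp4_hat" for X
    using Sp4_hat_unitary(1)[OF that] by (simp add: norm_eq_sqrt_inner inner_cmat_eq_trace trace_I)
  then have "bounded Sp4_hat" by (auto simp: bounded_iff)
  moreover have "closed Sp4_hat"
    unfolding Sp4_hat_def
    by (intro closed_Collect_conj closed_Collect_eq continuous_intros)
  ultimately show ?thesis by (simp add: compact_eq_bounded_closed)
qed

lemma continuous_on_Phi5: "continuous_on Sp4_hat Phi5"
proof -
  have "continuous_on Sp4_hat (\<lambda>G. \<chi> i j. (G ** F5 j ** conj_transpose G) \<bullet> F5 i / 4)"
    by (intro continuous_on_vec_lambda continuous_intros) auto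
  then show ?thesis
    by (rule continuous_on_eq) (simp add: vec_eq_iff Phi5_nth)
qed

lemma covering_space_Phi5: "covering_space Sp4_hat Phi5 SO"
  unfolding Phi5_image[symmetric]
proof (rule covering_space_mod_sign[OF compact_Sp4_hat _ _ continuous_on_Phi5])
  show "0 \<notin> Sp4_hat"
    using Sp4_hat_unitary(1)[of 0] mat_1_neq_0 by force
qed (simp_all add: Sp4_hat_uminus Phi5_eq_iff)

section \<open>Curves and Lie algebras\<close>

text \<open>Both curves start at the identity, so the product rule at 0 adds their velocities. Sums
  of velocities are thus realized inside the group.\<close>

lemma curve_at_one_mult:
  assumes "curve_at_one G \<gamma> A" "curve_at_one G \<delta> B"
    and "\<And>X Y. X \<in> G \<Longrightarrow> Y \<in> G \<Longrightarrow> X ** Y \<in> G"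
  shows "curve_at_one G (\<lambda>t. \<gamma> t ** \<delta> t) (A + B)"
proof -
  have "((\<lambda>t. \<gamma> t ** \<delta> t) has_vector_derivative \<gamma> 0 ** B + A ** \<delta> 0) (at 0)"
    using assms by (intro bounded_bilinear.has_vector_derivative[OF bounded_bilinear_matrix_mult])
      (simp_all add: curve_at_one_def)
  moreover have "(\<lambda>t. \<gamma> t ** \<delta> t) C1_differentiable_on UNIV"
    using assms by (intro C1_differentiable_on_matrix_mult) (simp_all add: curve_at_one_def)
  moreover have "\<gamma> t ** \<delta> t \<in> G" for t
    using assms(1,2) by (intro assms(3)) (auto simp: curve_at_one_def)
  ultimately show ?thesis
    using assms(1,2) by (auto simp: curve_at_one_def add.commute)
qed

lemma lie_algebra_of_sum:
  assumes G: "mat 1 \<in> G" "\<And>X Y. X \<in> G \<Longrightarrow> Y \<in> G \<Longrightarrow> X ** Y \<in> G"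
    and "\<And>a. a \<in> S \<Longrightarrow> f a \<in> lie_algebra_of G"
  shows "sum f S \<in> lie_algebra_of G"
  using assms(3)
proof (induction S rule: infinite_finite_induct)
  case (insert a S)
  then have "f a \<in> lie_algebra_of G" "sum f S \<in> lie_algebra_of G" by auto
  then obtain \<gamma> \<delta> where "curve_at_one G \<gamma> (f a)" "curve_at_one G \<delta> (sum f S)"
    unfolding lie_algebra_of_def by blast
  then have "curve_at_one G (\<lambda>t. \<gamma> t ** \<delta> t) (f a + sum f S)"
    using G(2) by (rule curve_at_one_mult)
  then show ?case using insert by (auto simp: lie_algebra_of_def)
next
  \<comment> \<open>The constant curve serves the empty sum and also an infinite index set, over
    which \<open>sum\<close> is 0 by default.\<close>
  have "curve_at_one G (\<lambda>_. mat 1) 0"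
    using G(1) by (auto simp: curve_at_one_def)
  then have "0 \<in> lie_algebra_of G" by (auto simp: lie_algebra_of_def)
  then show "sum f {} \<in> lie_algebra_of G" "infinite S \<Longrightarrow> sum f S \<in> lie_algebra_of G" for S
    by simp_all
qed

text \<open>The constant c changes the speed only, and supplies all real multiples of the velocity
  at once.\<close>

lemma rotor_curve:
  assumes "i \<noteq> j"
  shows "curve_at_one Sp4_hat (\<lambda>t. cos (c * t) *\<^sub>R mat 1 + sin (c * t) *\<^sub>R (F5 i ** F5 j))
           (c *\<^sub>R (F5 i ** F5 j))"
proof -
  let ?g = "\<lambda>t. cos (c * t) *\<^sub>R mat 1 + sin (c * t) *\<^sub>R (F5 i ** F5 j)"
  let ?D = "\<lambda>t. (- sin (c * t) * c) *\<^sub>R mat 1 + (cos (c * t) * c) *\<^sub>R (F5 i ** F5 j)"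
  have D: "(?g has_vector_derivative ?D t) (at t)" for t
    by (auto intro!: derivative_eq_intros simp: has_real_derivative_iff_has_vector_derivative[symmetric])
  have "?g t \<in> Sp4_hat" for t
  proof -
    \<comment> \<open>Since F_i F_i = -1, multiplying this u by F_i on the left gives the value of
      the curve, which is therefore a product of two unit 1-vectors.\<close>
    define u where "u = - cos (c * t) *\<^sub>R axis i 1 + sin (c * t) *\<^sub>R (axis j 1 :: real^5)"
    have "u \<bullet> u = sin (c * t) * sin (c * t) + cos (c * t) * cos (c * t)"
      using assms by (simp add: u_def inner_diff_left inner_diff_right inner_axis_axis)
    then have "norm u = 1" by (simp add: norm_eq_1 flip: power2_eq_square)
    moreover have "vec5 (axis i 1) ** vec5 u = ?g t"
      by (simp add: u_def vec5_linear_simps matrix_mult_distribs matrix_mult_scale F5_square)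
    ultimately show ?thesis
      using vec5_pair_in_Sp4_hat[of u "axis i 1"] by (simp add: norm_axis_1)
  qed
  moreover have "continuous_on UNIV ?D"
    by (intro continuous_intros)
  then have "?g C1_differentiable_on UNIV"
    unfolding C1_differentiable_on_def using D by (intro exI[of _ ?D]) blast
  ultimately show ?thesis
    using D[of 0] by (auto simp: curve_at_one_def)
qed

lemma lie_algebra_of_Sp4_hat_subset: "lie_algebra_of Sp4_hat \<subseteq> sp4_hat"
proof
  fix A assume "A \<in> lie_algebra_of Sp4_hat"
  then obtain \<gamma> where g: "range \<gamma> \<subseteq> Sp4_hat" "\<gamma> 0 = mat 1" "(\<gamma> has_vector_derivative A) (at 0)"
    by (auto simp: lie_algebra_of_def curve_at_one_def)
  note prod = bounded_bilinear.has_vector_derivative[OF bounded_bilinear_matrix_mult]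
  have "((\<lambda>t. conj_transpose (\<gamma> t) ** \<gamma> t) has_vector_derivative
      conj_transpose (\<gamma> 0) ** A + conj_transpose A ** \<gamma> 0) (at 0)"
    by (intro prod bounded_linear.has_vector_derivative[OF bounded_linear_conj_transpose] g)
  moreover have "(\<lambda>t. conj_transpose (\<gamma> t) ** \<gamma> t) = (\<lambda>t. mat 1)"
    using g(1) by (auto simp: Sp4_hat_def)
  ultimately have "A + conj_transpose A = 0"
    using vector_derivative_unique_at[OF _ has_vector_derivative_const] g(2) by fastforce
  have "((\<lambda>t. transpose (\<gamma> t) ** Jhat4 ** \<gamma> t) has_vector_derivative
      transpose (\<gamma> 0) ** Jhat4 ** A + (transpose (\<gamma> 0) ** 0 + transpose A ** Jhat4) ** \<gamma> 0) (at 0)"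
    by (intro prod bounded_linear.has_vector_derivative[OF bounded_linear_transpose]
        has_vector_derivative_const g)
  moreover have "(\<lambda>t. transpose (\<gamma> t) ** Jhat4 ** \<gamma> t) = (\<lambda>t. Jhat4)"
    using g(1) by (auto simp: Sp4_hat_def)
  ultimately have "Jhat4 ** A + transpose A ** Jhat4 = 0"
    using vector_derivative_unique_at[OF _ has_vector_derivative_const] g(2) by fastforce
  with \<open>A + conj_transpose A = 0\<close> show "A \<in> sp4_hat"
    by (simp add: sp4_hat_def eq_neg_iff_add_eq_0 add.commute)
qed

section \<open>The infinitesimal action on 1-vectors\<close>

text \<open>The candidate for \<open>Psi5\<close>, defined without curves so that its algebra can be
  settled before the linearization is known to have a value.\<close>

definition ad5 :: "4 cmat \<Rightarrow> real^5^5" where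
  "ad5 A = matrix_wrt F5 (\<lambda>Z. A ** Z - Z ** A)"

lemma sp4_hat_bracket_V5:
  assumes A: "A \<in> sp4_hat" and Z: "Z \<in> V5"
  shows "A ** Z - Z ** A \<in> V5"
proof -
  have A': "conj_transpose A = - A" "transpose A ** Jhat4 = - (Jhat4 ** A)"
    using A by (simp_all add: sp4_hat_def)
  have Z': "conj_transpose Z = - Z" "transpose Z ** Jhat4 = Jhat4 ** Z"
    using Z V5_characterization by blast+
  have "transpose (A ** Z - Z ** A) ** Jhat4
      = transpose Z ** (transpose A ** Jhat4) - transpose A ** (transpose Z ** Jhat4)"
    by (simp add: transpose_linear_simps matrix_transpose_mul matrix_mult_distribs matrix_mul_assoc)
  also have "\<dots> = (transpose A ** Jhat4) ** (- Z) - (transpose Z ** Jhat4) ** A"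
    by (simp add: A' Z' matrix_mult_scale matrix_mul_assoc)
  also have "\<dots> = Jhat4 ** (A ** Z - Z ** A)"
    by (simp add: A' Z' matrix_mult_scale matrix_mult_distribs matrix_mul_assoc)
  finally have "transpose (A ** Z - Z ** A) ** Jhat4 = Jhat4 ** (A ** Z - Z ** A)" .
  moreover have "conj_transpose (A ** Z - Z ** A) = - (A ** Z - Z ** A)"
    by (simp add: conj_transpose_linear_simps conj_transpose_mult A' Z' matrix_mult_scale)
  moreover have "trace (A ** Z - Z ** A) = 0"
    by (simp add: trace_sub trace_mul_sym[of A Z])
  ultimately show ?thesis using V5_characterization by blast
qed

lemma ad5_nth:
  "A \<in> sp4_hat \<Longrightarrow> ad5 A $ i $ j = (A ** F5 j - F5 j ** A) \<bullet> F5 i / 4"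
  unfolding ad5_def by (rule matrix_wrt_F5_nth) (simp add: sp4_hat_bracket_V5)

lemma ad5_apply:
  "A \<in> sp4_hat \<Longrightarrow> vec5 (ad5 A *v x) = A ** vec5 x - vec5 x ** A"
  unfolding ad5_def
  by (rule matrix_wrt_F5_apply[symmetric])
    (auto intro!: linearI simp: sp4_hat_bracket_V5 matrix_mult_distribs matrix_mult_scale algebra_simps)

lemma ad5_eqI: "(\<And>x. A ** vec5 x - vec5 x ** A = vec5 (M *v x)) \<Longrightarrow> ad5 A = M"
  unfolding ad5_def by (rule matrix_wrt_F5_eqI)

lemma subspace_sp4_hat: "subspace sp4_hat"
  unfolding subspace_def sp4_hat_def
  by (auto simp: conj_transpose_linear_simps transpose_linear_simps matrix_mult_distribs
      matrix_mult_scale linear_0[OF linear_conj_transpose] linear_0[OF linear_transpose])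

lemma sp4_hat_commutator:
  assumes "X \<in> sp4_hat" "Y \<in> sp4_hat"
  shows "commutator X Y \<in> sp4_hat"
proof -
  have X: "conj_transpose X = - X" "transpose X ** Jhat4 = - (Jhat4 ** X)"
    and Y: "conj_transpose Y = - Y" "transpose Y ** Jhat4 = - (Jhat4 ** Y)"
    using assms by (simp_all add: sp4_hat_def)
  have "transpose (X ** Y - Y ** X) ** Jhat4
      = transpose Y ** (transpose X ** Jhat4) - transpose X ** (transpose Y ** Jhat4)"
    by (simp add: transpose_linear_simps matrix_transpose_mul matrix_mult_distribs matrix_mul_assoc)
  also have "\<dots> = (transpose X ** Jhat4) ** Y - (transpose Y ** Jhat4) ** X"
    by (simp add: X Y matrix_mult_scale matrix_mul_assoc)
  also have "\<dots> = - (Jhat4 ** (X ** Y - Y ** X))"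
    by (simp add: X Y matrix_mult_scale matrix_mult_distribs matrix_mul_assoc)
  finally show ?thesis
    by (simp add: sp4_hat_def commutator_def conj_transpose_linear_simps conj_transpose_mult
        X(1) Y(1) matrix_mult_scale)
qed

lemma ad5_add: "X \<in> sp4_hat \<Longrightarrow> Y \<in> sp4_hat \<Longrightarrow> ad5 (X + Y) = ad5 X + ad5 Y"
  by (rule ad5_eqI) (simp add: matrix_vector_mult_add_rdistrib vec5_linear_simps ad5_apply
      matrix_mult_distribs)

lemma ad5_scaleR: "X \<in> sp4_hat \<Longrightarrow> ad5 (c *\<^sub>R X) = c *\<^sub>R ad5 X"
  by (rule ad5_eqI) (simp add: vec5_linear_simps ad5_apply matrix_mult_distribs matrix_mult_scale
      scaleR_diff_right flip: scaleR_matrix_vector_assoc)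

text \<open>This is the Jacobi identity for brackets acting on the 1-vectors.\<close>

lemma ad5_commutator:
  assumes "X \<in> sp4_hat" "Y \<in> sp4_hat"
  shows "ad5 (commutator X Y) = commutator (ad5 X) (ad5 Y)"
proof (rule ad5_eqI)
  fix x
  have "vec5 (commutator (ad5 X) (ad5 Y) *v x)
      = X ** (Y ** vec5 x - vec5 x ** Y) - (Y ** vec5 x - vec5 x ** Y) ** X
        - (Y ** (X ** vec5 x - vec5 x ** X) - (X ** vec5 x - vec5 x ** X) ** Y)"
    using assms by (simp add: commutator_def matrix_vector_mult_diff_rdistrib vec5_linear_simps
        ad5_apply flip: matrix_vector_mul_assoc)
  then show "commutator X Y ** vec5 x - vec5 x ** commutator X Y
      = vec5 (commutator (ad5 X) (ad5 Y) *v x)"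
    by (simp add: commutator_def matrix_mult_distribs matrix_mul_assoc)
qed

text \<open>The adjoint of bracketing with A is bracketing with A^* = - A, so the operator is skew
  for the trace form, in which the generators are orthogonal and of equal norm.\<close>

lemma ad5_in_so:
  assumes A: "A \<in> sp4_hat"
  shows "ad5 A \<in> so"
proof -
  have A': "conj_transpose A = - A" using A by (simp add: sp4_hat_def)
  have skew: "(A ** X - X ** A) \<bullet> Y = - ((A ** Y - Y ** A) \<bullet> X)" for X Y
  proof -
    have "(A ** X - X ** A) \<bullet> Y = X \<bullet> (conj_transpose A ** Y - Y ** conj_transpose A)"
      by (simp only: inner_diff_left inner_diff_right inner_matrix_mult_left[of A X]
          inner_matrix_mult_right[of X A])
    also have "conj_transpose A ** Y - Y ** conj_transpose A = - (A ** Y - Y ** A)"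
      by (simp add: A' matrix_mult_scale)
    finally show ?thesis by (simp only: inner_minus_right inner_commute)
  qed
  have "transpose (ad5 A) $ i $ j = (- ad5 A) $ i $ j" for i j
    using skew[of "F5 i" "F5 j"] by (simp add: transpose_def ad5_nth[OF A])
  then show ?thesis by (simp add: so_def vec_eq_iff)
qed

lemma inj_on_ad5: "inj_on ad5 sp4_hat"
proof (rule inj_onI)
  fix X Y assume XY: "X \<in> sp4_hat" "Y \<in> sp4_hat" "ad5 X = ad5 Y"
  define Z where "Z = X - Y"
  have Z: "Z \<in> sp4_hat" unfolding Z_def using XY subspace_sp4_hat by (simp add: subspace_diff)
  have comm: "Z ** F5 i = F5 i ** Z" for i
  proof -
    have "X ** F5 i - F5 i ** X = Y ** F5 i - F5 i ** Y"
      using ad5_apply[OF XY(1), of "axis i 1"] ad5_apply[OF XY(2), of "axis i 1"] XY(3) by simp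
    then show ?thesis by (simp add: Z_def matrix_mult_distribs algebra_simps)
  qed
  obtain c where c: "Z = mat c"
    using commutes_with_generators[OF surj_free_eval_F5 comm] by (rule commuting_with_all_scalar)
  \<comment> \<open>Skew-Hermitian scalars can be imaginary, as the volume element is; the condition
    on \<open>Jhat4\<close> gives c = - c and excludes them.\<close>
  have "(transpose Z ** Jhat4) $ 1 $ 2 = (- (Jhat4 ** Z)) $ 1 $ 2"
    using Z by (simp add: sp4_hat_def)
  then have "c = 0"
    by (simp add: c Jhat4_explicit matrix_matrix_mult_def sum_4 mat_def transpose_def)
  then show "X = Y" using c by (simp add: Z_def)
qed

text \<open>The bracket of F_k F_l with x is 2 x_k F_l - 2 x_l F_k, and each unordered pair occurs
  twice in the double sum: hence the 4. The minus sign makes the coefficient of x_l F_k equal to +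
  B_kl.\<close>

definition bivector5 :: "real^5^5 \<Rightarrow> 4 cmat" where
  "bivector5 B = (\<Sum>k\<in>UNIV. \<Sum>l\<in>UNIV. (- B $ k $ l / 4) *\<^sub>R (F5 k ** F5 l))"

text \<open>The rotor curve with c = 1 has this product as its velocity.\<close>

lemma F5_product_in_sp4_hat:
  assumes "k \<noteq> l"
  shows "F5 k ** F5 l \<in> sp4_hat"
proof -
  have "1 *\<^sub>R (F5 k ** F5 l) \<in> lie_algebra_of Sp4_hat"
    unfolding lie_algebra_of_def using rotor_curve[OF assms] by blast
  then show ?thesis using lie_algebra_of_Sp4_hat_subset by auto
qed

lemma so_skew:
  assumes "B \<in> so"
  shows "B $ l $ k = - (B $ k $ l)"
proof -
  have "transpose B $ k $ l = (- B) $ k $ l" using assms by (simp add: so_def)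
  then show ?thesis by (simp add: transpose_def)
qed

lemma so_diagonal: "B \<in> so \<Longrightarrow> B $ k $ k = 0"
  using so_skew[of B k k] by simp

lemma bivector5_in_sp4_hat:
  assumes "B \<in> so"
  shows "bivector5 B \<in> sp4_hat"
proof -
  have "(- B $ k $ l / 4) *\<^sub>R (F5 k ** F5 l) \<in> sp4_hat" for k l
  proof (cases "k = l")
    case True
    then show ?thesis using so_diagonal[OF assms] subspace_0[OF subspace_sp4_hat] by simp
  next
    case False
    then show ?thesis by (intro subspace_mul[OF subspace_sp4_hat] F5_product_in_sp4_hat)
  qed
  then show ?thesis
    unfolding bivector5_def by (intro subspace_sum[OF subspace_sp4_hat])
qed

lemma bivector5_in_lie_algebra:
  assumes "B \<in> so"
  shows "bivector5 B \<in> lie_algebra_of Sp4_hat"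
proof -
  note sum = lie_algebra_of_sum[OF Sp4_hat_one Sp4_hat_mult]
  have "(- B $ k $ l / 4) *\<^sub>R (F5 k ** F5 l) \<in> lie_algebra_of Sp4_hat" for k l
  proof (cases "k = l")
    case True
    then show ?thesis using sum[of "{}"] so_diagonal[OF assms] by simp
  next
    case False
    then show ?thesis unfolding lie_algebra_of_def using rotor_curve by blast
  qed
  then show ?thesis unfolding bivector5_def by (intro sum)
qed

lemma ad5_bivector5:
  assumes "B \<in> so"
  shows "ad5 (bivector5 B) = B"
proof (rule ad5_eqI)
  fix x
  have br: "F5 k ** F5 l ** vec5 x - vec5 x ** (F5 k ** F5 l)
      = (2 * x $ k) *\<^sub>R F5 l - (2 * x $ l) *\<^sub>R F5 k" for k l
  proof -
    have ac: "F5 i ** vec5 x + vec5 x ** F5 i = (- 2 * x $ i) *\<^sub>R mat 1" for i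
      using vec5_anticommutator[of "axis i 1" x] by (simp add: inner_axis')
    \<comment> \<open>Adding and subtracting F_k x F_l expresses the commutator through two
      anticommutators, which are scalars.\<close>
    have "F5 k ** F5 l ** vec5 x - vec5 x ** (F5 k ** F5 l)
        = F5 k ** (F5 l ** vec5 x + vec5 x ** F5 l) - (F5 k ** vec5 x + vec5 x ** F5 k) ** F5 l"
      by (simp add: matrix_mult_distribs matrix_mul_assoc)
    then show ?thesis by (simp add: ac matrix_mult_scale)
  qed
  have "bivector5 B ** vec5 x - vec5 x ** bivector5 B
      = (\<Sum>k\<in>UNIV. \<Sum>l\<in>UNIV. (- B $ k $ l / 4) *\<^sub>R
          (F5 k ** F5 l ** vec5 x - vec5 x ** (F5 k ** F5 l)))"
    by (simp add: bivector5_def matrix_mult_sum_left matrix_mult_sum_right matrix_mult_scale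
        sum_subtractf sum_negf scaleR_diff_right)
  also have "\<dots> = (\<Sum>k\<in>UNIV. \<Sum>l\<in>UNIV. (B $ l $ k * x $ k / 2) *\<^sub>R F5 l)
      + (\<Sum>k\<in>UNIV. \<Sum>l\<in>UNIV. (B $ k $ l * x $ l / 2) *\<^sub>R F5 k)"
    unfolding br sum.distrib[symmetric]
  proof (intro sum.cong refl)
    fix k l
    show "(- B $ k $ l / 4) *\<^sub>R ((2 * x $ k) *\<^sub>R F5 l - (2 * x $ l) *\<^sub>R F5 k)
        = (B $ l $ k * x $ k / 2) *\<^sub>R F5 l + (B $ k $ l * x $ l / 2) *\<^sub>R F5 k"
      by (simp add: so_skew[OF assms, of l k] scaleR_diff_right mult.commute)
  qed
  \<comment> \<open>After the skew-symmetry of B has been used, the two halves differ only by the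
    names of the indices.\<close>
  also have "(\<Sum>k\<in>UNIV. \<Sum>l\<in>UNIV. (B $ l $ k * x $ k / 2) *\<^sub>R F5 l)
      = (\<Sum>k\<in>UNIV. \<Sum>l\<in>UNIV. (B $ k $ l * x $ l / 2) *\<^sub>R F5 k)"
    by (rule sum.swap)
  also have "\<dots> + \<dots> = vec5 (B *v x)"
    by (simp add: vec5_def matrix_vector_mult_def scaleR_sum_left mult.commute
        flip: sum.distrib scaleR_add_left)
  finally show "bivector5 B ** vec5 x - vec5 x ** bivector5 B = vec5 (B *v x)" .
qed

lemma bij_betw_ad5: "bij_betw ad5 sp4_hat so"
  unfolding bij_betw_def
  using inj_on_ad5 ad5_in_so bivector5_in_sp4_hat ad5_bivector5 by (force simp: image_iff)

text \<open>A and the bivector built from \<open>ad5 A\<close> have the same image under the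
  injective \<open>ad5\<close>, so they coincide, and bivectors are velocities of products of rotor
  curves.\<close>

lemma lie_algebra_of_Sp4_hat: "lie_algebra_of Sp4_hat = sp4_hat"
proof (intro equalityI lie_algebra_of_Sp4_hat_subset subsetI)
  fix A assume A: "A \<in> sp4_hat"
  then have "bivector5 (ad5 A) = A"
    by (meson inj_onD[OF inj_on_ad5] ad5_bivector5 ad5_in_so bivector5_in_sp4_hat)
  then show "A \<in> lie_algebra_of Sp4_hat"
    using bivector5_in_lie_algebra[OF ad5_in_so[OF A]] by simp
qed

section \<open>The differential of the covering map\<close>

lemma Phi5_curve_derivative:
  assumes "curve_at_one Sp4_hat \<gamma> A"
  shows "(Phi5 \<circ> \<gamma> has_vector_derivative ad5 A) (at 0)"
proof -
  \<comment> \<open>Polarizing the quadratic expression G F_j G^* gives a real-bilinear map. The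
    product rule yields Q 1 A + Q A 1, and A^* = - A turns this into the bracket.\<close>
  define Q :: "4 cmat \<Rightarrow> 4 cmat \<Rightarrow> real^5^5" where
    "Q X Y = (\<chi> i j. (X ** F5 j ** conj_transpose Y) \<bullet> F5 i / 4)" for X Y
  have g: "range \<gamma> \<subseteq> Sp4_hat" "\<gamma> 0 = mat 1" "(\<gamma> has_vector_derivative A) (at 0)"
    using assms by (auto simp: curve_at_one_def)
  have A: "A \<in> sp4_hat"
    using assms lie_algebra_of_Sp4_hat by (auto simp: lie_algebra_of_def)
  then have A': "conj_transpose A = - A" by (simp add: sp4_hat_def)
  have "bounded_bilinear Q"
    unfolding bilinear_conv_bounded_bilinear[symmetric] bilinear_def Q_def
    by (auto intro!: linearI simp: vec_eq_iff matrix_mult_distribs matrix_mult_scale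
        conj_transpose_linear_simps inner_add_left add_divide_distrib)
  then have "((\<lambda>t. Q (\<gamma> t) (\<gamma> t)) has_vector_derivative Q (\<gamma> 0) A + Q A (\<gamma> 0)) (at 0)"
    by (rule bounded_bilinear.has_vector_derivative) (rule g)+
  moreover have "(\<lambda>t. Q (\<gamma> t) (\<gamma> t)) = Phi5 \<circ> \<gamma>"
    using g(1) by (auto simp: fun_eq_iff vec_eq_iff Q_def Phi5_nth image_subset_iff)
  moreover have "Q (\<gamma> 0) A + Q A (\<gamma> 0) = ad5 A"
    by (simp add: vec_eq_iff Q_def g A' ad5_nth[OF A] matrix_mult_scale inner_diff_left diff_divide_distrib)
  ultimately show ?thesis by simp
qed

text \<open>Every curve with velocity A yields the derivative \<open>ad5 A\<close>; that at least
  one such curve exists makes the definite description unique.\<close>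

lemma Psi5_eq_ad5:
  assumes "A \<in> sp4_hat"
  shows "Psi5 A = ad5 A"
proof -
  obtain \<gamma> where \<gamma>: "curve_at_one Sp4_hat \<gamma> A"
    using assms lie_algebra_of_Sp4_hat by (auto simp: lie_algebra_of_def)
  show ?thesis
    unfolding Psi5_def linearization_def Spin5_eq_Sp4_hat
  proof (rule the_equality)
    fix D assume "\<forall>\<gamma>. curve_at_one Sp4_hat \<gamma> A \<longrightarrow> (Phi5 \<circ> \<gamma> has_vector_derivative D) (at 0)"
    then show "D = ad5 A"
      using \<gamma> Phi5_curve_derivative vector_derivative_unique_at by blast
  qed (simp add: Phi5_curve_derivative)
qed

lemma lie_algebra_iso_Psi5: "lie_algebra_iso sp4_hat so Psi5"
proof -
  have "bij_betw Psi5 sp4_hat so"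
    using bij_betw_ad5 bij_betw_cong[of sp4_hat Psi5 ad5] Psi5_eq_ad5 by blast
  then show ?thesis
    using subspace_sp4_hat unfolding lie_algebra_iso_def
    by (simp add: Psi5_eq_ad5 subspace_add subspace_mul sp4_hat_commutator ad5_add ad5_scaleR
        ad5_commutator)
qed

theorem proposition3p1:
  shows
   "(inj F5 \<and> independent (range F5) \<and> one_vector_basis 0 5 F5)
    \<and> Jhat4 = block4 J2 0 0 (- J2) \<and> invertible Jhat4
    \<comment> \<open>(i), (ii)\<close>
    \<and> ((\<exists>!\<phi>. is_reversion V5 \<phi>) \<and>
       (\<forall>X. reversion V5 X = matrix_inv Jhat4 ** transpose X ** Jhat4))
    \<and> ((\<exists>!\<phi>. is_clifford_conj V5 \<phi>) \<and>
       (\<forall>X. clifford_conj V5 X = conj_transpose X))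
    \<comment> \<open>(iii)\<close>
    \<and> Spin5 = Sp4_hat
    \<comment> \<open>(iv)\<close>
    \<and> (covering_space Spin5 Phi5 SO
       \<and> (\<forall>X\<in>Spin5. \<forall>Y\<in>Spin5. X ** Y \<in> Spin5 \<and> Phi5 (X ** Y) = Phi5 X ** Phi5 Y)
       \<and> (\<forall>G\<in>Sp4_hat. (\<forall>Y\<in>V5. G ** Y ** conj_transpose G \<in> V5) \<and>
            Phi5 G = matrix_wrt F5 (\<lambda>Y. G ** Y ** conj_transpose G)))
    \<comment> \<open>(v)\<close>
    \<and> (lie_algebra_of Sp4_hat = sp4_hat
       \<and> (\<forall>\<gamma> A. curve_at_one Sp4_hat \<gamma> A \<longrightarrow>
            (Phi5 \<circ> \<gamma> has_vector_derivative Psi5 A) (at 0))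
       \<and> lie_algebra_iso sp4_hat so Psi5
       \<and> (\<forall>A\<in>sp4_hat. (\<forall>Z\<in>V5. A ** Z - Z ** A \<in> V5) \<and>
            Psi5 A = matrix_wrt F5 (\<lambda>Z. A ** Z - Z ** A)))"
proof (intro conjI allI ballI impI)
  show "\<exists>!\<phi>. is_reversion V5 \<phi>"
    using is_reversion_V5 is_reversion_V5_unique by blast
  show "\<exists>!\<phi>. is_clifford_conj V5 \<phi>"
    using is_clifford_conj_V5 is_clifford_conj_V5_unique by blast
  show "Jhat4 = block4 J2 0 0 (- J2)" by (rule Jhat4_eq_block4)
  show "Phi5 (X ** Y) = Phi5 X ** Phi5 Y" if "X \<in> Spin5" "Y \<in> Spin5" for X Y
    using that by (simp add: Spin5_eq_Sp4_hat Phi5_mult)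
  show "Psi5 A = matrix_wrt F5 (\<lambda>Z. A ** Z - Z ** A)" if "A \<in> sp4_hat" for A
    using Psi5_eq_ad5[OF that] by (simp add: ad5_def)
  show "(Phi5 \<circ> \<gamma> has_vector_derivative Psi5 A) (at 0)" if "curve_at_one Sp4_hat \<gamma> A" for \<gamma> A
  proof -
    have "A \<in> sp4_hat" using that lie_algebra_of_Sp4_hat by (auto simp: lie_algebra_of_def)
    then show ?thesis using Phi5_curve_derivative[OF that] by (simp add: Psi5_eq_ad5)
  qed
qed (simp_all add: inj_F5 independent_F5 one_vector_basis_F5 invertible_Jhat4
    reversion_V5 clifford_conj_V5 Spin5_eq_Sp4_hat covering_space_Phi5 Sp4_hat_mult
    Sp4_hat_conj_V5 Phi5_eq_matrix_wrt lie_algebra_of_Sp4_hat lie_algebra_iso_Psi5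
    sp4_hat_bracket_V5)

end
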